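(* Let $V_0,V_1$ be finite dimensional real vector spaces with lattices $\Lambda_0,\Lambda_1$. Let $C_{0,1}$ be a closed polyhedral rational cone in $V_0\oplus V_1$ (containing the origin), so that for any $\mu\in\Lambda_1$ the set $P(\mu)=\{\xi\in V_0:(\xi,\mu)\in C_{0,1}\}$ is a rational polyhedron in $V_0$. Let $P$ be a rational polyhedron in $V_0$, and assume that for any $\mu\in\Lambda_1$ the set $P\cap P(\mu)$ is compact. Thus, for $m=q_P[C_P]\in\mathcal{S}(\Lambda_0)$, with $q_P$ a quasi-polynomial function on $\Lambda_0\oplus\mathbb{Z}$, and for $c(\lambda,\mu)$ a quasi-polynomial function on $\Lambda_0\oplus\Lambda_1$, one can compute, for $(\mu,k)\in\Lambda_1\oplus\mathbb{Z}$, $$m_c(\mu,k)=\sum_{\lambda\in\Lambda_0,\ (\lambda,\mu)\in C_{0,1}}m(\lambda,k)\,c(\lambda,\mu).$$ Then the function $m_c$ belongs to $\mathcal{S}(\Lambda_1)$.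
   Context: A function $f$ on a lattice $L$ is periodic if there is a positive integer $D$ such that $f(\lambda_0+D\lambda)=f(\lambda_0)$ for all $\lambda,\lambda_0\in L$. The algebra of quasi-polynomial functions on $L$ is the algebra of functions on $L$ generated by polynomials and periodic functions. A cone is always a closed convex polyhedral cone containing $0$. For a finite dimensional real vector space $V$ with lattice $\Lambda$ and a rational polyhedron $P\subset V$ (possibly with empty interior), let $C_P=\{(t\xi,t):t\ge0,\ \xi\in P\}\subset V\oplus\mathbb{R}$ and let $[C_P]$ be its characteristic function. For $q$ a quasi-polynomial function on $\Lambda\oplus\mathbb{Z}$, $q[C_P]$ is the function on $\Lambda\oplus\mathbb{Z}$ equal to $q(\lambda,k)$ if $(\lambda,k)\in C_P$ and to $0$ otherwise. $\mathcal{S}(\Lambda)$ is the space of functions on $\Lambda\oplus\mathbb{Z}$ linearly generated by the functions $q[C_P]$, where $P$ runs over rational polyhedra in $V$ and $q$ over quasi-polynomial functions on $\Lambda\oplus\mathbb{Z}$; $\mathcal{S}(\Lambda_0)$ and $\mathcal{S}(\Lambda_1)$ are these spaces for $(V_0,\Lambda_0)$ and $(V_1,\Lambda_1)$.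
   Formalization: Membership of m_c in S(Λ_1) is proved only for k ≠ 0: m_c agrees there with an element of S(Λ_1). At k = 0 the claim fails in general (P={0}, C_{0,1}=R², all functions 1). Where the sum has infinitely many nonzero terms and does not converge, it is taken to be 0. *)

theory Defs
  imports "HOL-Analysis.Analysis"
begin

(* A finite-dimensional real vector space is a linear subspace V of a Euclidean space
   (DIM('a) is never 0, whereas V = {0} is allowed). *)
definition lattice_in :: "'a::euclidean_space set \<Rightarrow> 'a set \<Rightarrow> bool" where
  "lattice_in V L \<longleftrightarrow>
     (\<exists>B. independent B \<and> span B = V \<and>
          L = {(\<Sum>b\<in>B. of_int (n b) *\<^sub>R b) | n :: 'a \<Rightarrow> int. True})"

definition rational_polyhedron :: "'a::euclidean_space set \<Rightarrow> 'a set \<Rightarrow> 'a set \<Rightarrow> bool" where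
  "rational_polyhedron V L P \<longleftrightarrow>
     (\<exists>F :: (('a \<Rightarrow> real) \<times> real) set.
        finite F \<and> (\<forall>(l, a)\<in>F. linear l \<and> l ` L \<subseteq> \<rat> \<and> a \<in> \<rat>) \<and>
        P = {x \<in> V. \<forall>(l, a)\<in>F. l x \<le> a})"

definition rational_cone :: "'a::euclidean_space set \<Rightarrow> 'a set \<Rightarrow> 'a set \<Rightarrow> bool" where
  "rational_cone V L C \<longleftrightarrow> rational_polyhedron V L C \<and> cone C \<and> 0 \<in> C"

(* A function on a lattice L is represented by a function on the ambient space whose
   values outside L are irrelevant. *)
definition periodic_on :: "'a::euclidean_space set \<Rightarrow> ('a \<Rightarrow> complex) \<Rightarrow> bool" where
  "periodic_on L f \<longleftrightarrow>
     (\<exists>D::nat. D > 0 \<and> (\<forall>x0\<in>L. \<forall>x\<in>L. f (x0 + real D *\<^sub>R x) = f x0))"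

definition polynomial_on :: "'a::euclidean_space set \<Rightarrow> ('a \<Rightarrow> complex) \<Rightarrow> bool" where
  "polynomial_on L f \<longleftrightarrow> (\<exists>p. polynomial_function p \<and> (\<forall>x\<in>L. f x = p x))"

(* The generated algebra; constants are among the generators. *)
inductive_set quasi_polynomials :: "'a::euclidean_space set \<Rightarrow> ('a \<Rightarrow> complex) set"
  for L :: "'a set" where
  poly: "polynomial_on L f \<Longrightarrow> f \<in> quasi_polynomials L"
| periodic: "periodic_on L f \<Longrightarrow> f \<in> quasi_polynomials L"
| add: "f \<in> quasi_polynomials L \<Longrightarrow> g \<in> quasi_polynomials L \<Longrightarrow>
        (\<lambda>x. f x + g x) \<in> quasi_polynomials L"
| mult: "f \<in> quasi_polynomials L \<Longrightarrow> g \<in> quasi_polynomials L \<Longrightarrow>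
        (\<lambda>x. f x * g x) \<in> quasi_polynomials L"

(* The slice t = 0 is {0} (or empty), not the recession cone of P: on that slice every function
   in S_space below is supported at the origin. A sum push_sum need not be (take P = {0}, all
   functions 1 and C everything); in general it agrees with an element of S_space only off k = 0. *)
definition cone_over :: "'a::euclidean_space set \<Rightarrow> ('a \<times> real) set" where
  "cone_over P = {(t *\<^sub>R \<xi>, t) | t \<xi>. 0 \<le> t \<and> \<xi> \<in> P}"

definition cut_off :: "('a::euclidean_space \<times> real \<Rightarrow> complex) \<Rightarrow> 'a set \<Rightarrow> 'a \<times> real \<Rightarrow> complex" where
  "cut_off q P x = (if x \<in> cone_over P then q x else 0)"

(* The set \<int> of integers inside the reals is the second factor of the lattice, so that
   L \<times> \<int> is a lattice in V \<times> UNIV. *)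
definition S_space :: "'a::euclidean_space set \<Rightarrow> 'a set \<Rightarrow> ('a \<times> real \<Rightarrow> complex) set" where
  "S_space V L =
     {s. \<exists>(N::nat) (a :: nat \<Rightarrow> complex) q P.
           (\<forall>i<N. rational_polyhedron V L (P i) \<and> q i \<in> quasi_polynomials (L \<times> \<int>)) \<and>
           (\<forall>x \<in> L \<times> \<int>. s x = (\<Sum>i<N. a i * cut_off (q i) (P i) x))}"

definition fibre :: "'a set \<Rightarrow> ('a \<times> 'b) set \<Rightarrow> 'b \<Rightarrow> 'a set" where
  "fibre V C \<mu> = {\<xi> \<in> V. (\<xi>, \<mu>) \<in> C}"

(* The index set is infinite in general, hence infsum; where only finitely many terms are
   nonzero this is the finite sum of those terms. *)
definition push_sum ::
  "'a set \<Rightarrow> ('a \<times> 'b) set \<Rightarrow> ('a \<times> real \<Rightarrow> complex) \<Rightarrow> ('a \<times> 'b \<Rightarrow> complex)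
     \<Rightarrow> 'b \<times> real \<Rightarrow> complex" where
  "push_sum L C m c = (\<lambda>(\<mu>, k). \<Sum>\<^sub>\<infinity>x\<in>{x \<in> L. (x, \<mu>) \<in> C}. m (x, k) * c (x, \<mu>))"

end

(* Choosing lattice bases, the claim is about sums of a quasi-polynomial q over the integer points of
   a homogeneous rational cone K in (lambda, mu, k)-space, taken over the fibres of the projection
   forgetting lambda; for k > 0 the condition (xi, k) in C_P is a system of homogeneous inequalities.

   If K contains no nonzero integer point with mu = 0 and k = 0, all fibres are finite and the
   coordinates of lambda are summed out one at a time, as in Fourier-Motzkin elimination: splitting K
   by comparing bounds leaves one upper and one lower bound for the current coordinate, and a
   quasi-polynomial restricted to a residue class of that coordinate is a polynomial, which has a
   polynomial antidifference. The result is a sum of quasi-polynomials cut off by cones inside the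
   rational shadow of K, so that pointedness is inherited.

   Otherwise K is mapped into itself by translation along a nonzero integer vector v in the fibre
   direction; q is a polynomial along suitable arithmetic progressions in direction v, so a fibre
   sum converges unconditionally only if all its terms vanish. Then every push_sum with k > 0 is 0,
   by the convention of infsum in the divergent case. Compactness of P \<inter> P(mu) is assumed for
   lattice points mu only and does not exclude this: slices with k > 1 see the points mu / k. *)
theory Submission
  imports Defs
begin

section \<open>Quasi-polynomials in integer coordinates\<close>

text \<open>Forms are encoded as additive maps. Homogeneity over the integers follows, and the
  coefficients are recovered as the values on \<open>unit_vec\<close>.\<close>

definition additive_form :: "(('i \<Rightarrow> int) \<Rightarrow> int) \<Rightarrow> bool" where
  "additive_form l \<longleftrightarrow> (\<forall>z w. l (\<lambda>i. z i + w i) = l z + l w)"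

definition unit_vec :: "'i \<Rightarrow> 'i \<Rightarrow> int" where
  "unit_vec b = (\<lambda>i. if i = b then 1 else 0)"

lemma additive_form_add: "additive_form l \<Longrightarrow> l (\<lambda>i. z i + w i) = l z + l w"
  by (simp add: additive_form_def)

lemma additive_form_zero: "additive_form l \<Longrightarrow> l (\<lambda>_. 0) = 0"
  using additive_form_add[of l "\<lambda>_. 0" "\<lambda>_. 0"] by simp

lemma additive_form_minus: "additive_form l \<Longrightarrow> l (\<lambda>i. - z i) = - l z"
  using additive_form_add[of l z "\<lambda>i. - z i"] additive_form_zero[of l] by simp

lemma additive_form_scale:
  assumes l: "additive_form l"
  shows "l (\<lambda>i. n * z i) = n * l z"
proof -
  have nat: "l (\<lambda>i. int m * z i) = int m * l z" for m
    by (induction m) (simp_all add: additive_form_zero[OF l] additive_form_add[OF l] distrib_right)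
  show ?thesis
  proof (cases n rule: int_cases2)
    case (nonneg m) then show ?thesis using nat by simp
  next
    case (nonpos m) then show ?thesis
      using nat[of m] additive_form_minus[OF l, of "\<lambda>i. int m * z i"] by simp
  qed
qed

lemma additive_form_upd:
  assumes "additive_form l"
  shows "l (z(b := x)) = l (z(b := 0)) + x * l (unit_vec b)"
proof -
  have "z(b := x) = (\<lambda>i. (z(b := 0)) i + x * unit_vec b i)"
    by (auto simp: unit_vec_def)
  then show ?thesis
    using assms by (metis additive_form_add additive_form_scale)
qed

lemma additive_form_upd_const:
  assumes "additive_form l" "l (unit_vec b) = 0"
  shows "l (z(b := x)) = l z"
  using additive_form_upd[OF assms(1), of z b x] additive_form_upd[OF assms(1), of z b "z b"] assms(2)
  by simp

lemma additive_form_upd0: "additive_form l \<Longrightarrow> additive_form (\<lambda>z. l (z(b := 0)))"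
  unfolding additive_form_def
proof (intro allI)
  fix z w :: "'a \<Rightarrow> int"
  assume l: "\<forall>z w. l (\<lambda>i. z i + w i) = l z + l w"
  have "(\<lambda>i. z i + w i)(b := 0) = (\<lambda>i. (z(b := 0)) i + (w(b := 0)) i)" by (rule ext) simp
  then show "l ((\<lambda>i. z i + w i)(b := 0)) = l (z(b := 0)) + l (w(b := 0))" using l by metis
qed

text \<open>The coordinates are summed over a finite support, since the index type itself may be
  infinite. This expansion later turns a form at a lattice point into a real linear
  functional.\<close>

lemma additive_form_support:
  assumes l: "additive_form l" and J: "finite J" and z: "\<And>i. i \<notin> J \<Longrightarrow> z i = 0"
  shows "l z = (\<Sum>i\<in>J. z i * l (unit_vec i))"
  using J z
proof (induction J arbitrary: z rule: finite_induct)
  case empty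
  then have "z = (\<lambda>_. 0)" by auto
  then show ?case using additive_form_zero[OF l] by simp
next
  case (insert j J)
  have "l (z(j := 0)) = (\<Sum>i\<in>J. (z(j := 0)) i * l (unit_vec i))"
    by (rule insert.IH) (use insert.prems in auto)
  also have "\<dots> = (\<Sum>i\<in>J. z i * l (unit_vec i))"
    using insert.hyps by (intro sum.cong) auto
  finally show ?case
    using additive_form_upd[OF l, of z j "z j"] insert.hyps by simp
qed

section \<open>Rational cones and the algebra of quasi-polynomials\<close>

definition lattice_cone :: "(('i \<Rightarrow> int) \<Rightarrow> int) set \<Rightarrow> ('i \<Rightarrow> int) set" where
  "lattice_cone F = {z. \<forall>l\<in>F. l z \<le> 0}"

text \<open>Constants are covered by the periodic generators with \<open>D = 1\<close>; products and
  sums of forms then give polynomials.\<close>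

inductive_set qpoly :: "(('i \<Rightarrow> int) \<Rightarrow> complex) set" where
  form: "additive_form l \<Longrightarrow> (\<lambda>z. of_int (l z)) \<in> qpoly"
| periodic: "D > 0 \<Longrightarrow> (\<And>z w. p (\<lambda>i. z i + D * w i) = p z) \<Longrightarrow> p \<in> qpoly"
| add: "f \<in> qpoly \<Longrightarrow> g \<in> qpoly \<Longrightarrow> (\<lambda>z. f z + g z) \<in> qpoly"
| mult: "f \<in> qpoly \<Longrightarrow> g \<in> qpoly \<Longrightarrow> (\<lambda>z. f z * g z) \<in> qpoly"

lemma qpoly_const: "(\<lambda>_. c) \<in> qpoly"
  by (rule qpoly.periodic[of 1]) auto

lemma qpoly_minus: "f \<in> qpoly \<Longrightarrow> (\<lambda>z. - f z) \<in> qpoly"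
  using qpoly.mult[OF qpoly_const[of "-1"]] by simp

lemma qpoly_diff: "f \<in> qpoly \<Longrightarrow> g \<in> qpoly \<Longrightarrow> (\<lambda>z. f z - g z) \<in> qpoly"
  using qpoly.add[OF _ qpoly_minus] by simp

lemma qpoly_sum: "(\<And>j. j \<in> J \<Longrightarrow> f j \<in> qpoly) \<Longrightarrow> (\<lambda>z. \<Sum>j\<in>J. f j z) \<in> qpoly"
  by (induction J rule: infinite_finite_induct) (auto intro: qpoly_const qpoly.add)

text \<open>The quotient is \<open>l z + a\<close> minus its residue, divided by \<open>d\<close>,
  and the residue has period \<open>d\<close>. Summation bounds rounded to integers are of this
  shape.\<close>

lemma qpoly_form_div:
  assumes l: "additive_form l" and d: "d > 0"
  shows "(\<lambda>z. of_int ((l z + a) div d)) \<in> qpoly"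
proof -
  have "(\<lambda>z. of_int ((l z + a) mod d)) \<in> qpoly"
  proof (rule qpoly.periodic[OF d])
    fix z w
    have "l (\<lambda>i. z i + d * w i) + a = (l z + a) + d * l w"
      by (simp add: additive_form_add[OF l] additive_form_scale[OF l])
    then have "(l (\<lambda>i. z i + d * w i) + a) mod d = (l z + a) mod d"
      by (metis mod_mult_self2)
    then show "of_int ((l (\<lambda>i. z i + d * w i) + a) mod d) = of_int ((l z + a) mod d)"
      by simp
  qed
  then have "(\<lambda>z. (1 / of_int d) * (of_int (l z) + of_int a - of_int ((l z + a) mod d))) \<in> qpoly"
    by (intro qpoly.mult qpoly_diff qpoly.add qpoly_const qpoly.form[OF l])
  also have "(\<lambda>z. (1 / of_int d) * (of_int (l z) + of_int a - of_int ((l z + a) mod d)))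
    = (\<lambda>z. of_int ((l z + a) div d) :: complex)"
  proof
    fix z
    have "of_int (l z) + of_int a - of_int ((l z + a) mod d)
        = (of_int d * of_int ((l z + a) div d) :: complex)"
      unfolding of_int_mult[symmetric] of_int_add[symmetric] of_int_diff[symmetric]
      by (simp add: minus_mod_eq_mult_div)
    then show "(1 / of_int d) * (of_int (l z) + of_int a - of_int ((l z + a) mod d))
      = (of_int ((l z + a) div d) :: complex)" using d by simp
  qed
  finally show ?thesis .
qed

section \<open>Polynomials in one integer variable with quasi-polynomial coefficients\<close>

inductive_set qpoly_poly :: "(('i \<Rightarrow> int) \<Rightarrow> int \<Rightarrow> complex) set" where
  monom: "f \<in> qpoly \<Longrightarrow> (\<lambda>z t. f z * of_int t ^ n) \<in> qpoly_poly"
| add: "f \<in> qpoly_poly \<Longrightarrow> g \<in> qpoly_poly \<Longrightarrow> (\<lambda>z t. f z t + g z t) \<in> qpoly_poly"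

lemma qpoly_poly_coeff: "f \<in> qpoly \<Longrightarrow> (\<lambda>z t. f z) \<in> qpoly_poly"
  using qpoly_poly.monom[of f 0] by simp

lemma qpoly_poly_var: "(\<lambda>z t. of_int t) \<in> qpoly_poly"
  using qpoly_poly.monom[OF qpoly_const[of 1], of 1] by simp

lemma qpoly_poly_mult:
  assumes "f \<in> qpoly_poly" and "g \<in> qpoly_poly"
  shows "(\<lambda>z t. f z t * g z t) \<in> qpoly_poly"
  using assms(1)
proof induction
  case f: (monom f n)
  from assms(2) show ?case
  proof induction
    case (monom g m)
    then show ?case
      using qpoly_poly.monom[OF qpoly.mult[OF f monom], of "n + m"]
      by (simp add: power_add mult_ac)
  next
    case (add g1 g2)
    then show ?case using qpoly_poly.add by (auto simp: distrib_left)
  qed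
next
  case (add f1 f2)
  then show ?case using qpoly_poly.add by (auto simp: distrib_right)
qed

lemma qpoly_poly_const: "(\<lambda>_ _. c) \<in> qpoly_poly"
  by (rule qpoly_poly_coeff[OF qpoly_const])

lemma qpoly_power: "f \<in> qpoly \<Longrightarrow> (\<lambda>z. f z ^ n) \<in> qpoly"
  by (induction n) (auto intro: qpoly_const qpoly.mult)

text \<open>Used to evaluate an antidifference at the ends of a summation interval, which are
  themselves quasi-polynomial in the remaining coordinates.\<close>

lemma qpoly_poly_subst:
  assumes "G \<in> qpoly_poly" and u: "(\<lambda>z. of_int (u z)) \<in> qpoly"
  shows "(\<lambda>z. G z (u z)) \<in> qpoly"
  using assms(1) by induction (intro qpoly.intros(3,4) qpoly_power u, assumption+)+

section \<open>Antidifferences and telescoping sums\<close>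

lemma power_antidifference:
  "\<exists>p :: complex poly. \<forall>t. poly p (t + 1) - poly p t = t ^ n"
proof (induction n rule: less_induct)
  case (less n)
  then have "\<forall>i. \<exists>p :: complex poly. i < n \<longrightarrow> (\<forall>t. poly p (t + 1) - poly p t = t ^ i)"
    by blast
  from choice[OF this] obtain p :: "nat \<Rightarrow> complex poly"
    where p: "\<And>i t. i < n \<Longrightarrow> poly (p i) (t + 1) - poly (p i) t = t ^ i" by blast
  \<comment> \<open>By the binomial theorem the difference of \<open>t ^ Suc n\<close> is
    \<open>Suc n\<close> times \<open>t ^ n\<close> plus lower powers; the antidifferences
    \<open>p i\<close> remove the lower powers.\<close>
  define r where "r = monom 1 (Suc n) - (\<Sum>i<n. smult (of_nat (Suc n choose i)) (p i))"
  have "poly r (t + 1) - poly r t = of_nat (Suc n) * t ^ n" for t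
  proof -
    have "(t + 1) ^ Suc n = (\<Sum>i\<le>Suc n. of_nat (Suc n choose i) * t ^ i)"
      by (subst binomial_ring) simp
    also have "\<dots> = (\<Sum>i<n. of_nat (Suc n choose i) * t ^ i) + of_nat (Suc n) * t ^ n + t ^ Suc n"
      by (simp add: lessThan_Suc_atMost[symmetric] del: power_Suc)
    finally have e: "(t + 1) ^ Suc n - t ^ Suc n
      = (\<Sum>i<n. of_nat (Suc n choose i) * t ^ i) + of_nat (Suc n) * t ^ n" by simp
    have s: "(\<Sum>i<n. of_nat (Suc n choose i) * (poly (p i) (t + 1) - poly (p i) t))
      = (\<Sum>i<n. of_nat (Suc n choose i) * t ^ i)"
      by (intro sum.cong) (auto simp: p)
    have "poly r (t + 1) - poly r t = ((t + 1) ^ Suc n - t ^ Suc n)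
      - (\<Sum>i<n. of_nat (Suc n choose i) * (poly (p i) (t + 1) - poly (p i) t))"
      unfolding r_def
      by (simp add: poly_monom poly_sum right_diff_distrib sum_subtractf del: power_Suc of_nat_Suc)
    also have "\<dots> = of_nat (Suc n) * t ^ n" unfolding e s by simp
    finally show ?thesis .
  qed
  then have "poly (smult (1 / of_nat (Suc n)) r) (t + 1) - poly (smult (1 / of_nat (Suc n)) r) t
      = t ^ n" for t
    by (simp add: diff_divide_distrib[symmetric] del: of_nat_Suc)
  then show ?case by (intro exI allI)
qed

lemma qpoly_poly_of_poly: "(\<lambda>z t. poly p (of_int t)) \<in> qpoly_poly"
  by (induction p)
    (auto intro!: qpoly_poly_const qpoly_poly.add qpoly_poly_mult qpoly_poly_var)

lemma qpoly_poly_antidifference: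
  assumes "g \<in> qpoly_poly"
  shows "\<exists>G\<in>qpoly_poly. \<forall>z t. G z (t + 1) - G z t = g z t"
  using assms
proof induction
  case (monom f n)
  obtain p :: "complex poly" where p: "\<And>t. poly p (t + 1) - poly p t = t ^ n"
    using power_antidifference by blast
  show ?case
  proof (intro bexI allI)
    show "(\<lambda>z t. f z * poly p (of_int t)) \<in> qpoly_poly"
      by (intro qpoly_poly_mult qpoly_poly_of_poly qpoly_poly_coeff monom)
  qed (simp add: p right_diff_distrib[symmetric])
next
  case (add f g)
  then obtain F G where "F \<in> qpoly_poly" "G \<in> qpoly_poly"
    and FG: "\<And>z t. F z (t + 1) - F z t = f z t" "\<And>z t. G z (t + 1) - G z t = g z t" by blast
  then show ?case
    by (intro bexI[of _ "\<lambda>z t. F z t + G z t"] allI qpoly_poly.add) (simp only: add_diff_add FG)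
qed

text \<open>The bound \<open>m \<le> n + 1\<close> admits exactly one kind of empty interval,
  \<open>m = n + 1\<close>, where both sides are 0. For smaller \<open>n\<close> the sum is still 0,
  but the right-hand side need not be.\<close>

lemma sum_int_telescope:
  fixes G :: "int \<Rightarrow> 'a::ab_group_add"
  assumes "\<And>t. G (t + 1) - G t = g t" and "m \<le> n + 1"
  shows "(\<Sum>t\<in>{m..n}. g t) = G (n + 1) - G m"
proof -
  have "(\<Sum>t\<in>{m..m + int k - 1}. g t) = G (m + int k) - G m" for k
  proof (induction k)
    case (Suc k)
    have "{m..m + int (Suc k) - 1} = insert (m + int k) {m..m + int k - 1}" by auto
    then show ?case using Suc assms(1)[of "m + int k"] by (simp add: algebra_simps)
  qed simp
  from this[of "nat (n + 1 - m)"] show ?thesis using assms(2) by simp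
qed

text \<open>
  Stated for all multiples of the period, so that a common period for two functions is just a product.
\<close>
lemma qpoly_upd_progression:
  assumes "q \<in> qpoly"
  shows "\<exists>D>0. \<forall>E. D dvd E \<longrightarrow> (\<forall>r. (\<lambda>z t. q (z(b := r + E * t))) \<in> qpoly_poly)"
  using assms
proof induction
  case (form l)
  have *: "(\<lambda>z t. of_int (l (z(b := r + E * t)))) \<in> qpoly_poly" for E r
  proof -
    have "(\<lambda>z t. of_int (l (z(b := 0))) + of_int (r * l (unit_vec b))
        + of_int (E * l (unit_vec b)) * of_int t) \<in> qpoly_poly"
      by (intro qpoly_poly.add qpoly_poly_mult qpoly_poly_var qpoly_poly_const
          qpoly_poly_coeff[OF qpoly.form] additive_form_upd0 form)
    then show ?thesis
      unfolding additive_form_upd[OF form, where b = b and x = "r + E * t" for t]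
      by (simp add: algebra_simps)
  qed
  show ?case by (intro exI[of _ 1] conjI allI impI * zero_less_one)
next
  case (periodic D p)
  have *: "(\<lambda>z t. p (z(b := r + E * t))) \<in> qpoly_poly" if "D dvd E" for E r
  proof -
    from that obtain k where E: "E = D * k" by blast
    have "p (z(b := r + E * t)) = p (z(b := r))" for z t
    proof -
      have "z(b := r + E * t) = (\<lambda>i. (z(b := r)) i + D * (k * t * unit_vec b i))"
        by (auto simp: unit_vec_def E)
      then show ?thesis using periodic(2)[of "z(b := r)"] by metis
    qed
    moreover have "(\<lambda>z. p (z(b := r))) \<in> qpoly"
    proof (rule qpoly.periodic[OF periodic(1)])
      fix z w :: "'a \<Rightarrow> int"
      have "(\<lambda>i. z i + D * w i)(b := r) = (\<lambda>i. (z(b := r)) i + D * (w(b := 0)) i)" by auto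
      then show "p ((\<lambda>i. z i + D * w i)(b := r)) = p (z(b := r))" using periodic(2) by metis
    qed
    ultimately show ?thesis using qpoly_poly_coeff by simp
  qed
  show ?case by (intro exI[of _ D] conjI allI impI periodic(1) *)
next
  case (add f g)
  from add.IH(1) obtain D1 where D1: "D1 > 0"
    and f: "\<forall>E. D1 dvd E \<longrightarrow> (\<forall>r. (\<lambda>z t. f (z(b := r + E * t))) \<in> qpoly_poly)"
    by (elim exE conjE)
  from add.IH(2) obtain D2 where D2: "D2 > 0"
    and g: "\<forall>E. D2 dvd E \<longrightarrow> (\<forall>r. (\<lambda>z t. g (z(b := r + E * t))) \<in> qpoly_poly)"
    by (elim exE conjE)
  have *: "(\<lambda>z t. f (z(b := r + E * t)) + g (z(b := r + E * t))) \<in> qpoly_poly"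
    if "D1 * D2 dvd E" for E r
    using qpoly_poly.add[OF f[rule_format, OF dvd_mult_left[OF that]] g[rule_format, OF dvd_mult_right[OF that]]] .
  show ?case by (intro exI[of _ "D1 * D2"] conjI allI impI mult_pos_pos[OF D1 D2] *)
next
  case (mult f g)
  from mult.IH(1) obtain D1 where D1: "D1 > 0"
    and f: "\<forall>E. D1 dvd E \<longrightarrow> (\<forall>r. (\<lambda>z t. f (z(b := r + E * t))) \<in> qpoly_poly)"
    by (elim exE conjE)
  from mult.IH(2) obtain D2 where D2: "D2 > 0"
    and g: "\<forall>E. D2 dvd E \<longrightarrow> (\<forall>r. (\<lambda>z t. g (z(b := r + E * t))) \<in> qpoly_poly)"
    by (elim exE conjE)
  have *: "(\<lambda>z t. f (z(b := r + E * t)) * g (z(b := r + E * t))) \<in> qpoly_poly"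
    if "D1 * D2 dvd E" for E r
    using qpoly_poly_mult[OF f[rule_format, OF dvd_mult_left[OF that]] g[rule_format, OF dvd_mult_right[OF that]]] .
  show ?case by (intro exI[of _ "D1 * D2"] conjI allI impI mult_pos_pos[OF D1 D2] *)
qed

section \<open>Eliminating one coordinate\<close>

text \<open>The parameter \<open>A\<close> contains every cone that occurs, so that pointedness of
  \<open>A\<close> passes to all of them. Differences are sums with a negated
  quasi-polynomial.\<close>

inductive_set cone_qpoly :: "('i \<Rightarrow> int) set \<Rightarrow> (('i \<Rightarrow> int) \<Rightarrow> complex) set" for A where
  cone: "finite F \<Longrightarrow> (\<And>l. l \<in> F \<Longrightarrow> additive_form l) \<Longrightarrow> lattice_cone F \<subseteq> A \<Longrightarrow> q \<in> qpoly \<Longrightarrow>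
    (\<lambda>z. if z \<in> lattice_cone F then q z else 0) \<in> cone_qpoly A"
| add: "f \<in> cone_qpoly A \<Longrightarrow> g \<in> cone_qpoly A \<Longrightarrow> (\<lambda>z. f z + g z) \<in> cone_qpoly A"

lemma cone_qpoly_mono: "f \<in> cone_qpoly A \<Longrightarrow> A \<subseteq> B \<Longrightarrow> f \<in> cone_qpoly B"
proof (induction rule: cone_qpoly.induct)
  case (cone F q)
  show ?case by (rule cone_qpoly.cone) (use cone in auto)
next
  case (add f g)
  show ?case by (rule cone_qpoly.add) (use add in auto)
qed

text \<open>For a cone this concerns only the directions within \<open>B\<close>: the fibres over
  the coordinates outside \<open>B\<close> have no nonzero integral recession vector. The cone may
  still contain lines in other directions.\<close>

definition pointed_on :: "'i set \<Rightarrow> ('i \<Rightarrow> int) set \<Rightarrow> bool" where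
  "pointed_on B A \<longleftrightarrow> (\<forall>w\<in>A. (\<forall>i. i \<notin> B \<longrightarrow> w i = 0) \<longrightarrow> w = (\<lambda>_. 0))"

lemma pointed_on_subset: "pointed_on B A \<Longrightarrow> A' \<subseteq> A \<Longrightarrow> pointed_on B A'"
  by (auto simp: pointed_on_def)

text \<open>For a cone \<open>A\<close> this is its projection along coordinate \<open>b\<close>
  over the rationals, with denominators cleared by \<open>N\<close>. Projecting integer points alone
  would be too small: the bounds on coordinate \<open>b\<close> may admit a rational value but no
  integer.\<close>

definition rat_shadow :: "'i \<Rightarrow> ('i \<Rightarrow> int) set \<Rightarrow> ('i \<Rightarrow> int) set" where
  "rat_shadow b A = {z. \<exists>N>0. \<exists>x. (\<lambda>i. N * z i)(b := x) \<in> A}"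

lemma rat_shadow_mono: "A \<subseteq> A' \<Longrightarrow> rat_shadow b A \<subseteq> rat_shadow b A'"
  unfolding rat_shadow_def by blast

text \<open>The result does not depend on \<open>z b\<close>. An infinite line would contribute 0 by
  the convention of \<open>sum\<close>; for a cone given by finitely many forms and pointed at
  \<open>{b}\<close> every line is finite.\<close>

definition line_sum ::
  "'i \<Rightarrow> (('i \<Rightarrow> int) \<Rightarrow> int) set \<Rightarrow> (('i \<Rightarrow> int) \<Rightarrow> complex) \<Rightarrow> ('i \<Rightarrow> int) \<Rightarrow> complex" where
  "line_sum b F q z = (\<Sum>x | z(b := x) \<in> lattice_cone F. q (z(b := x)))"

lemma additive_form_combine:
  assumes "additive_form l" "additive_form l'"
  shows "additive_form (\<lambda>z. a * l z + c * l' z)"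
  unfolding additive_form_def
  by (simp add: additive_form_add[OF assms(1)] additive_form_add[OF assms(2)] algebra_simps)

lemma int_le_div_iff:
  fixes d :: int
  assumes "d > 0"
  shows "t \<le> n div d \<longleftrightarrow> t * d \<le> n"
proof
  assume "t \<le> n div d"
  then have "t * d \<le> n div d * d" using assms by simp
  also have "\<dots> \<le> n"
    using assms div_mult_mod_eq[of n d] pos_mod_sign[OF assms, of n] by linarith
  finally show "t * d \<le> n" .
next
  assume "t * d \<le> n"
  then have "(t * d) div d \<le> n div d" using assms by (intro zdiv_mono1)
  then show "t \<le> n div d" using assms by simp
qed

text \<open>In each residue class of coordinate \<open>b\<close> modulo a suitable \<open>D\<close>,
  the sum runs over an interval whose ends are rounded quotients of forms, and the summand is a
  polynomial in the position. Its antidifference at the two ends is a quasi-polynomial, valid on the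
  cone where the bounds are compatible.\<close>

lemma line_sum_two_bounds:
  fixes F0 :: "(('i \<Rightarrow> int) \<Rightarrow> int) set"
  assumes F0: "finite F0" "\<And>l. l \<in> F0 \<Longrightarrow> additive_form l" "\<And>l. l \<in> F0 \<Longrightarrow> l (unit_vec b) = 0"
    and lu: "additive_form lu" "lu (unit_vec b) > 0"
    and ll: "additive_form ll" "ll (unit_vec b) < 0"
    and q: "q \<in> qpoly"
  shows "line_sum b (insert lu (insert ll F0)) q
    \<in> cone_qpoly (rat_shadow b (lattice_cone (insert lu (insert ll F0))))"
proof -
  \<comment> \<open>Both \<open>a\<close> and \<open>c\<close> are positive: \<open>lu\<close>
    bounds coordinate \<open>b\<close> above by \<open>- U z / a\<close>, and \<open>ll\<close>
    bounds it below by \<open>L z / c\<close>.\<close>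
  define a where "a = lu (unit_vec b)"
  define c where "c = - ll (unit_vec b)"
  define U where "U z = lu (z(b := 0))" for z
  define L where "L z = ll (z(b := 0))" for z
  \<comment> \<open>The combination that cancels coordinate \<open>b\<close>:
    \<open>h z \<le> 0\<close> says that the rational lower bound does not exceed the rational upper
    bound.\<close>
  define h where "h z = c * lu z + a * ll z" for z
  have a: "a > 0" and c: "c > 0" using lu ll by (auto simp: a_def c_def)
  have lu_upd: "lu (z(b := x)) = U z + x * a" for z x
    unfolding a_def U_def by (rule additive_form_upd[OF lu(1)])
  have ll_upd: "ll (z(b := x)) = L z - x * c" for z x
    using additive_form_upd[OF ll(1), of z b x] by (simp add: c_def L_def)
  have F0_upd: "l (z(b := x)) = l z" if "l \<in> F0" for l z x
    by (rule additive_form_upd_const[OF F0(2)[OF that] F0(3)[OF that]])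
  have h: "additive_form h" unfolding h_def by (intro additive_form_combine lu ll)
  have h_eq: "h z = c * U z + a * L z" for z
  proof -
    have "lu z = U z + z b * a" "ll z = L z - z b * c"
      using lu_upd[of z "z b"] ll_upd[of z "z b"] by simp_all
    then show ?thesis unfolding h_def by (simp only:) (simp add: algebra_simps)
  qed
  have mem: "z(b := x) \<in> lattice_cone (insert lu (insert ll F0)) \<longleftrightarrow>
      (\<forall>l\<in>F0. l z \<le> 0) \<and> U z + x * a \<le> 0 \<and> L z \<le> x * c" for z x
  proof -
    have "(\<forall>l\<in>F0. l (z(b := x)) \<le> 0) \<longleftrightarrow> (\<forall>l\<in>F0. l z \<le> 0)"
      by (intro ball_cong refl) (simp only: F0_upd)
    then show ?thesis by (auto simp: lattice_cone_def lu_upd ll_upd)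
  qed
  have mem': "z \<in> lattice_cone (insert h F0) \<longleftrightarrow> (\<forall>l\<in>F0. l z \<le> 0) \<and> c * U z + a * L z \<le> 0" for z
    by (auto simp: lattice_cone_def h_eq)
  obtain D where D: "D > 0"
    and DE: "\<forall>E. D dvd E \<longrightarrow> (\<forall>r. (\<lambda>z t. q (z(b := r + E * t))) \<in> qpoly_poly)"
    using qpoly_upd_progression[OF q, of b] by (elim exE conjE)
  have "(\<lambda>z t. q (z(b := r + D * t))) \<in> qpoly_poly" for r
    using DE by (elim allE[of _ D]) simp
  then have "\<forall>r. \<exists>G. G \<in> qpoly_poly \<and> (\<forall>z t. G z (t + 1) - G z t = q (z(b := r + D * t)))"
    using qpoly_poly_antidifference by fast
  from choice[OF this] obtain G where G: "\<And>r. G r \<in> qpoly_poly"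
    and G_step: "\<And>r z t. G r z (t + 1) - G r z t = q (z(b := r + D * t))" by blast
  \<comment> \<open>These are the bounds on \<open>t\<close> for coordinate values
    \<open>r + D * t\<close>: \<open>hi\<close> is rounded down, and \<open>lo\<close> is rounded
    up, written as a negated floor.\<close>
  define hi where "hi r z = (- U z - a * r) div (a * D)" for r z
  define lo where "lo r z = - ((c * r - L z) div (c * D))" for r z
  define Q where "Q z = (\<Sum>r\<in>{0..<D}. G r z (hi r z + 1) - G r z (lo r z))" for z
  have le_hi: "t \<le> hi r z \<longleftrightarrow> U z + (r + D * t) * a \<le> 0" for t r z
  proof -
    have "t \<le> hi r z \<longleftrightarrow> t * (a * D) \<le> - U z - a * r"
      unfolding hi_def using a D by (intro int_le_div_iff) simp
    moreover have "(r + D * t) * a = t * (a * D) + a * r" by (simp add: algebra_simps)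
    ultimately show ?thesis by linarith
  qed
  have lo_le: "lo r z \<le> t \<longleftrightarrow> L z \<le> (r + D * t) * c" for t r z
  proof -
    have "lo r z \<le> t \<longleftrightarrow> - t \<le> (c * r - L z) div (c * D)"
      unfolding lo_def by linarith
    also have "\<dots> \<longleftrightarrow> - t * (c * D) \<le> c * r - L z"
      using c D by (intro int_le_div_iff) simp
    moreover have "(r + D * t) * c = c * r - (- t) * (c * D)" by (simp add: algebra_simps)
    ultimately show ?thesis by linarith
  qed
  have "Q \<in> qpoly"
  proof -
    have U': "additive_form (\<lambda>z. - U z)" and L': "additive_form (\<lambda>z. - L z)"
      using additive_form_upd0[OF lu(1), of b] additive_form_upd0[OF ll(1), of b]
      unfolding additive_form_def U_def L_def by auto
    have hi: "(\<lambda>z. of_int (hi r z + 1)) \<in> qpoly" for r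
      using qpoly.add[OF qpoly_form_div[OF U', of "a * D" "- (a * r)"] qpoly_const[of 1]] a D
      by (simp add: hi_def)
    have lo: "(\<lambda>z. of_int (lo r z)) \<in> qpoly" for r
      using qpoly_minus[OF qpoly_form_div[OF L', of "c * D" "c * r"]] c D
      by (simp add: lo_def)
    have "(\<lambda>z. G r z (hi r z + 1) - G r z (lo r z)) \<in> qpoly" for r
      by (rule qpoly_diff[OF qpoly_poly_subst[OF G hi] qpoly_poly_subst[OF G lo]])
    then have "(\<lambda>z. \<Sum>r\<in>{0..<D}. G r z (hi r z + 1) - G r z (lo r z)) \<in> qpoly"
      by (rule qpoly_sum)
    then show ?thesis by (simp add: Q_def[abs_def])
  qed
  have "line_sum b (insert lu (insert ll F0)) q
    = (\<lambda>z. if z \<in> lattice_cone (insert h F0) then Q z else 0)"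
  proof
    fix z
    show "line_sum b (insert lu (insert ll F0)) q z
      = (if z \<in> lattice_cone (insert h F0) then Q z else 0)"
    proof (cases "z \<in> lattice_cone (insert h F0)")
      case True
      have lo_hi: "lo r z \<le> hi r z + 1" for r
      proof (rule ccontr)
        assume "\<not> lo r z \<le> hi r z + 1"
        then have "U z + (r + D * (hi r z + 1)) * a > 0" "L z > (r + D * (hi r z + 1)) * c"
          using le_hi[of "hi r z + 1" r z] lo_le[of r z "hi r z + 1"] by auto
        then have "c * (U z + (r + D * (hi r z + 1)) * a) > 0"
          "a * L z > a * ((r + D * (hi r z + 1)) * c)"
          using a c by auto
        then have "c * U z + a * L z > 0" by (simp add: algebra_simps)
        then show False using True by (simp add: mem')
      qed
      have "line_sum b (insert lu (insert ll F0)) q z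
          = (\<Sum>(r, t)\<in>Sigma {0..<D} (\<lambda>r. {lo r z..hi r z}). q (z(b := r + D * t)))"
        unfolding line_sum_def
      proof (rule sum.reindex_bij_witness[where
            i = "\<lambda>(r, t). r + D * t" and j = "\<lambda>x. (x mod D, x div D)"])
        fix x assume "x \<in> {x. z(b := x) \<in> lattice_cone (insert lu (insert ll F0))}"
        then show "(x mod D, x div D) \<in> Sigma {0..<D} (\<lambda>r. {lo r z..hi r z})"
          using D by (auto simp: mem lo_le le_hi)
      next
        fix p assume "p \<in> Sigma {0..<D} (\<lambda>r. {lo r z..hi r z})"
        then show "(case p of (r, t) \<Rightarrow> r + D * t)
            \<in> {x. z(b := x) \<in> lattice_cone (insert lu (insert ll F0))}"
          using True by (auto simp: mem mem' lo_le le_hi)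
      qed (use D in \<open>auto split: prod.splits\<close>)
      also have "\<dots> = (\<Sum>r\<in>{0..<D}. \<Sum>t\<in>{lo r z..hi r z}. q (z(b := r + D * t)))"
        by (subst sum.Sigma) auto
      also have "\<dots> = Q z"
        unfolding Q_def by (intro sum.cong refl sum_int_telescope G_step lo_hi)
      finally show ?thesis using True by simp
    next
      case False
      have "{x. z(b := x) \<in> lattice_cone (insert lu (insert ll F0))} = {}"
      proof (rule ccontr)
        assume "\<not> ?thesis"
        then obtain x where x: "\<forall>l\<in>F0. l z \<le> 0" "U z + x * a \<le> 0" "L z \<le> x * c"
          by (auto simp: mem)
        then have "c * (U z + x * a) \<le> 0" "a * L z \<le> a * (x * c)"
          using a c by (auto simp: mult_le_0_iff)
        then have "c * U z + a * L z \<le> 0" by (simp add: algebra_simps)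
        then show False using False x(1) by (simp add: mem')
      qed
      then show ?thesis using False by (simp add: line_sum_def)
    qed
  qed
  \<comment> \<open>Scaling by \<open>a\<close> makes the upper bound for coordinate
    \<open>b\<close> the integer \<open>- U z\<close>. At this value \<open>lu\<close> holds with
    equality, and \<open>h z \<le> 0\<close> gives the lower bound.\<close>
  moreover have "lattice_cone (insert h F0) \<subseteq> rat_shadow b (lattice_cone (insert lu (insert ll F0)))"
  proof
    fix z assume z: "z \<in> lattice_cone (insert h F0)"
    have upd: "(\<lambda>i. a * z i)(b := 0) = (\<lambda>i. a * (z(b := 0)) i)" by (rule ext) simp
    have "U (\<lambda>i. a * z i) = a * U z" "L (\<lambda>i. a * z i) = a * L z"
      unfolding U_def L_def upd by (intro additive_form_scale lu ll)+
    moreover have "l (\<lambda>i. a * z i) \<le> 0" if "l \<in> F0" for l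
      using z that a additive_form_scale[OF F0(2)[OF that]] by (simp add: mem' mult_le_0_iff)
    ultimately have "(\<lambda>i. a * z i)(b := - U z) \<in> lattice_cone (insert lu (insert ll F0))"
      using z unfolding mem mem' by (simp add: algebra_simps)
    then show "z \<in> rat_shadow b (lattice_cone (insert lu (insert ll F0)))"
      using a unfolding rat_shadow_def by blast
  qed
  ultimately show ?thesis
    using cone_qpoly.cone[OF _ _ _ \<open>Q \<in> qpoly\<close>, of "insert h F0"] F0(1,2) h by auto
qed

text \<open>Induction on the number of forms that involve coordinate \<open>b\<close>. Of two bounds
  on the same side one is redundant on each side of the hyperplane where they agree, so cutting
  there removes a bound from every piece. Without such a pair, pointedness leaves exactly one upper
  and one lower bound.\<close>

lemma line_sum_cone_qpoly:
  assumes "finite F" "\<And>l. l \<in> F \<Longrightarrow> additive_form l" "q \<in> qpoly"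
    and "pointed_on {b} (lattice_cone F)"
  shows "line_sum b F q \<in> cone_qpoly (rat_shadow b (lattice_cone F))"
  using assms
proof (induction "card {l \<in> F. l (unit_vec b) \<noteq> 0}" arbitrary: F q rule: less_induct)
  case less
  note fin = less.prems(1) and add = less.prems(2) and pointed = less.prems(4)
  show ?case
  proof (cases "\<exists>l1\<in>F. \<exists>l2\<in>F. l1 \<noteq> l2 \<and> l1 (unit_vec b) * l2 (unit_vec b) > 0")
    case True
    then obtain l1 l2 where l: "l1 \<in> F" "l2 \<in> F" "l1 \<noteq> l2"
      and pos: "l1 (unit_vec b) * l2 (unit_vec b) > 0" by blast
    define a1 where "a1 = \<bar>l1 (unit_vec b)\<bar>"
    define a2 where "a2 = \<bar>l2 (unit_vec b)\<bar>"
    \<comment> \<open>The coefficients of \<open>l1\<close> and \<open>l2\<close> at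
      \<open>b\<close> have the same sign, so these weights cancel coordinate
      \<open>b\<close>.\<close>
    define h where "h z = a1 * l2 z + (- a2) * l1 z" for z
    define h' where "h' z = (- a1) * l2 z + a2 * l1 z" for z
    have a: "a1 > 0" "a2 > 0" using pos by (auto simp: a1_def a2_def)
    have h_add: "additive_form h" "additive_form h'"
      unfolding h_def h'_def by (intro additive_form_combine add l)+
    have h'_eq: "h' z = - h z" for z by (simp add: h_def h'_def)
    have h_unit: "h (unit_vec b) = 0"
      using pos by (auto simp: h_def a1_def a2_def zero_less_mult_iff)
    have h_upd: "h (z(b := x)) = h z" for z x
      by (rule additive_form_upd_const[OF h_add(1) h_unit])
    have l12: "l2 z \<le> 0" if "h z \<le> 0" "l1 z \<le> 0" for z
    proof -
      have "a1 * l2 z \<le> a2 * l1 z" using that(1) by (simp add: h_def)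
      also have "\<dots> \<le> 0" using that(2) a by (simp add: mult_le_0_iff)
      finally show ?thesis using a by (simp add: mult_le_0_iff)
    qed
    have l21: "l1 z \<le> 0" if "h z \<ge> 0" "l2 z \<le> 0" for z
    proof -
      have "a2 * l1 z \<le> a1 * l2 z" using that(1) by (simp add: h_def)
      also have "\<dots> \<le> 0" using that(2) a by (simp add: mult_le_0_iff)
      finally show ?thesis using a by (simp add: mult_le_0_iff)
    qed
    \<comment> \<open>The sign of \<open>h\<close> decides which of the two bounds \<open>l1\<close>, \<open>l2\<close> implies the other; it does not
      depend on coordinate \<open>b\<close>. The overlap \<open>h = 0\<close> is subtracted, so only closed cones occur.\<close>
    define F1 where "F1 = insert h (F - {l2})"
    define F2 where "F2 = insert h' (F - {l1})"
    define F3 where "F3 = insert h' F1"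
    have F1: "z \<in> lattice_cone F1 \<longleftrightarrow> h z \<le> 0 \<and> z \<in> lattice_cone F" for z
      using l l12[of z] by (auto simp: F1_def lattice_cone_def)
    have F2: "z \<in> lattice_cone F2 \<longleftrightarrow> h z \<ge> 0 \<and> z \<in> lattice_cone F" for z
      using l l21[of z] by (auto simp: F2_def lattice_cone_def h'_eq)
    have F3: "z \<in> lattice_cone F3 \<longleftrightarrow> h z = 0 \<and> z \<in> lattice_cone F" for z
      using F1[of z] by (auto simp: F3_def lattice_cone_def h'_eq)
    have IH: "line_sum b F' q' \<in> cone_qpoly (rat_shadow b (lattice_cone F))"
      if F': "F' \<in> {F1, F2, F3}" and q': "q' \<in> qpoly" for F' q'
    proof -
      have sub: "lattice_cone F' \<subseteq> lattice_cone F" using F' F1 F2 F3 by auto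
      have h'_unit: "h' (unit_vec b) = 0" using h_unit h'_eq by simp
      have "l1 (unit_vec b) \<noteq> 0" "l2 (unit_vec b) \<noteq> 0" using pos by auto
      moreover have "{l \<in> F'. l (unit_vec b) \<noteq> 0} \<subseteq> {l \<in> F. l (unit_vec b) \<noteq> 0} - {l1}
          \<or> {l \<in> F'. l (unit_vec b) \<noteq> 0} \<subseteq> {l \<in> F. l (unit_vec b) \<noteq> 0} - {l2}"
        using F' h_unit h'_unit unfolding F1_def F2_def F3_def by (elim insertE emptyE) blast+
      ultimately have "{l \<in> F'. l (unit_vec b) \<noteq> 0} \<subset> {l \<in> F. l (unit_vec b) \<noteq> 0}"
        using l by blast
      then have "card {l \<in> F'. l (unit_vec b) \<noteq> 0} < card {l \<in> F. l (unit_vec b) \<noteq> 0}"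
        using fin by (intro psubset_card_mono) auto
      moreover have "finite F'" using F' fin by (auto simp: F1_def F2_def F3_def)
      moreover have "additive_form l" if "l \<in> F'" for l
        using F' that add h_add by (auto simp: F1_def F2_def F3_def)
      ultimately have "line_sum b F' q' \<in> cone_qpoly (rat_shadow b (lattice_cone F'))"
        using less.hyps q' pointed_on_subset[OF pointed sub] by blast
      then show ?thesis using cone_qpoly_mono rat_shadow_mono[OF sub] by blast
    qed
    have "line_sum b F q z = line_sum b F1 q z + line_sum b F2 q z + line_sum b F3 (\<lambda>z. - q z) z" for z
      unfolding line_sum_def F1 F2 F3 h_upd
      by (cases "h z" "0 :: int" rule: linorder_cases) (simp_all add: sum_negf)
    then have "line_sum b F q
        = (\<lambda>z. line_sum b F1 q z + line_sum b F2 q z + line_sum b F3 (\<lambda>z. - q z) z)" by (rule ext)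
    also have "\<dots> \<in> cone_qpoly (rat_shadow b (lattice_cone F))"
      using less.prems(3) by (intro cone_qpoly.add IH qpoly_minus) simp_all
    finally show ?thesis .
  next
    case False
    have supp: "\<forall>i. i \<notin> {b} \<longrightarrow> unit_vec b i = 0" "\<forall>i. i \<notin> {b} \<longrightarrow> - unit_vec b i = 0"
      by (simp_all add: unit_vec_def)
    have "unit_vec b b \<noteq> 0" by (simp add: unit_vec_def)
    then have nz: "unit_vec b \<noteq> (\<lambda>_. 0)" "(\<lambda>i. - unit_vec b i) \<noteq> (\<lambda>_. 0)"
      by (metis, metis neg_equal_0_iff_equal)
    \<comment> \<open>Pointedness excludes both unit directions along \<open>b\<close> from the
      cone. A form violated by the positive direction is an upper bound, one violated by the
      negative direction a lower bound.\<close>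
    have "unit_vec b \<notin> lattice_cone F"
      using nz(1) by (rule contrapos_nn)
        (rule pointed[unfolded pointed_on_def, THEN bspec, THEN mp, OF _ supp(1)])
    then have "\<exists>lu\<in>F. lu (unit_vec b) > 0" by (simp add: lattice_cone_def not_le)
    then obtain lu where lu: "lu \<in> F" "lu (unit_vec b) > 0" by blast
    have "(\<lambda>i. - unit_vec b i) \<notin> lattice_cone F"
      using nz(2) by (rule contrapos_nn)
        (rule pointed[unfolded pointed_on_def, THEN bspec, THEN mp, OF _ supp(2)])
    then have "\<exists>ll\<in>F. ll (\<lambda>i. - unit_vec b i) > 0" by (simp add: lattice_cone_def not_le)
    then obtain ll where ll: "ll \<in> F" "ll (\<lambda>i. - unit_vec b i) > 0" by blast
    then have "ll (unit_vec b) < 0" using additive_form_minus[OF add[OF ll(1)], of "unit_vec b"] by simp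
    note l = lu ll(1) this
    define F0 where "F0 = {l \<in> F. l (unit_vec b) = 0}"
    have up: "l' = lu" if "l' \<in> F" "l' (unit_vec b) > 0" for l'
      using False l(1) that(1) mult_pos_pos[OF that(2) l(2)] by blast
    have um: "l' = ll" if "l' \<in> F" "l' (unit_vec b) < 0" for l'
      using False l(3) that(1) mult_neg_neg[OF that(2) l(4)] by blast
    have F_eq: "F = insert lu (insert ll F0)"
    proof (rule set_eqI)
      fix x show "x \<in> F \<longleftrightarrow> x \<in> insert lu (insert ll F0)"
        using l(1,3) up[of x] um[of x] unfolding F0_def
        by (cases "x (unit_vec b)" "0 :: int" rule: linorder_cases) auto
    qed
    show ?thesis
      unfolding F_eq
      by (rule line_sum_two_bounds) (use fin add l less.prems(3) in \<open>simp_all add: F0_def\<close>)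
  qed
qed

section \<open>Sums over fibres\<close>

lemma nat_incseq_subseq:
  fixes s :: "nat \<Rightarrow> nat"
  shows "\<exists>f. strict_mono f \<and> incseq (\<lambda>n. s (f n))"
proof -
  obtain f where f: "strict_mono f" "monoseq (\<lambda>n. s (f n))"
    using seq_monosub[of s] by blast
  from f(2) consider "incseq (\<lambda>n. s (f n))" | "decseq (\<lambda>n. s (f n))"
    by (auto simp: monoseq_iff)
  then show ?thesis
  proof cases
    case 1
    then show ?thesis using f by blast
  next
    case 2
    \<comment> \<open>A decreasing sequence of natural numbers is constant from the index of its
      least value on, so a tail of it is also increasing.\<close>
    obtain N where N: "\<And>n. s (f N) \<le> s (f n)"
      using ex_has_least_nat[of "\<lambda>_. True" 0 "\<lambda>n. s (f n)"] by blast
    have "s (f (n + N)) = s (f N)" for n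
      using N[of "n + N"] decseqD[OF 2, of N "n + N"] by simp
    then have "incseq (\<lambda>n. s (f (n + N)))" by simp
    moreover have "strict_mono (\<lambda>n. f (n + N))"
      using f(1) by (simp add: strict_mono_def)
    ultimately show ?thesis by (intro exI[of _ "\<lambda>n. f (n + N)"] conjI)
  qed
qed

text \<open>Subsequences of increasing sequences stay increasing, so the extraction can be repeated
  for the members of \<open>F\<close> one after another.\<close>

lemma common_incseq_subseq:
  fixes g :: "'l \<Rightarrow> nat \<Rightarrow> nat"
  assumes "finite F"
  shows "\<exists>r. strict_mono r \<and> (\<forall>l\<in>F. incseq (\<lambda>n. g l (r n)))"
  using assms
proof induction
  case empty
  show ?case by (intro exI[of _ id]) (simp add: strict_mono_def)
next
  case (insert l F)
  then obtain r where r: "strict_mono r" "\<And>l. l \<in> F \<Longrightarrow> incseq (\<lambda>n. g l (r n))" by blast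
  obtain f where f: "strict_mono f" "incseq (\<lambda>n. g l (r (f n)))"
    using nat_incseq_subseq[of "\<lambda>n. g l (r n)"] by blast
  have "incseq (\<lambda>n. g l' (r (f n)))" if "l' \<in> F" for l'
    using r(2)[OF that] strict_mono_mono[OF f(1)] by (simp add: mono_def)
  then show ?case
    using strict_mono_compose[OF r(1) f(1)] f(2) by (intro exI[of _ "\<lambda>n. r (f n)"]) auto
qed

section \<open>Finiteness and summation on fibres of pointed cones\<close>

definition fibre_off :: "'i set \<Rightarrow> ('i \<Rightarrow> int) \<Rightarrow> ('i \<Rightarrow> int) set" where
  "fibre_off B z = {w. \<forall>i. i \<notin> B \<longrightarrow> w i = z i}"

text \<open>
  Dickson's argument: among infinitely many integer points of a fibre, two differ by a nonzero
  element of the cone.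
\<close>
lemma finite_pointed_fibre:
  assumes F: "finite F" "\<And>l. l \<in> F \<Longrightarrow> additive_form l"
    and pointed: "pointed_on B (lattice_cone F)"
  shows "finite (lattice_cone F \<inter> fibre_off B z)"
proof (rule ccontr)
  assume "infinite (lattice_cone F \<inter> fibre_off B z)"
  then obtain f :: "nat \<Rightarrow> 'a \<Rightarrow> int" where f: "inj f" "range f \<subseteq> lattice_cone F \<inter> fibre_off B z"
    using infinite_countable_subset by blast
  \<comment> \<open>On the cone the slacks \<open>- l (f n)\<close> are natural numbers. If all of
    them grow from one point to a later one, the difference of the two points lies in the
    cone.\<close>
  obtain r where r: "strict_mono r" "\<And>l. l \<in> F \<Longrightarrow> incseq (\<lambda>n. nat (- l (f (r n))))"
    using common_incseq_subseq[OF F(1), of "\<lambda>l n. nat (- l (f n))"] by blast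
  define w where "w = (\<lambda>i. f (r 1) i + - f (r 0) i)"
  have "l w \<le> 0" if l: "l \<in> F" for l
  proof -
    have "l (f (r n)) \<le> 0" for n
      using f(2) l by (auto simp: lattice_cone_def)
    then have "l (f (r 1)) \<le> l (f (r 0))"
      using incseqD[OF r(2)[OF l], of 0 1] by (simp add: nat_le_eq_zle)
    then show ?thesis
      unfolding w_def additive_form_add[OF F(2)[OF l]] additive_form_minus[OF F(2)[OF l]] by simp
  qed
  moreover have "w i = 0" if "i \<notin> B" for i
  proof -
    have "f n i = z i" for n using f(2) that by (auto simp: fibre_off_def)
    then show ?thesis by (simp add: w_def)
  qed
  ultimately have w0: "w = (\<lambda>_. 0)" using pointed by (auto simp: pointed_on_def lattice_cone_def)
  have "f (r 1) i = f (r 0) i" for i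
    using fun_cong[OF w0, of i] by (simp add: w_def)
  then have "r 1 = r 0" using f(1) by (metis ext injD)
  then show False using strict_monoD[OF r(1), of 0 1] by simp
qed

text \<open>A point of the shadow supported in \<open>B\<close> lifts, after scaling, to a point of
  \<open>A\<close> supported in \<open>insert b B\<close>, which must vanish. Since \<open>b\<close>
  is not in \<open>B\<close>, coordinate \<open>b\<close> of the original point is 0
  already.\<close>

lemma pointed_on_rat_shadow:
  assumes pointed: "pointed_on (insert b B) A" and b: "b \<notin> B"
  shows "pointed_on B (rat_shadow b A)"
  unfolding pointed_on_def
proof (intro ballI impI)
  fix w assume "w \<in> rat_shadow b A" and supp: "\<forall>i. i \<notin> B \<longrightarrow> w i = 0"
  then obtain N x where N: "N > 0" "(\<lambda>i. N * w i)(b := x) \<in> A" by (auto simp: rat_shadow_def)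
  have "\<forall>i. i \<notin> insert b B \<longrightarrow> ((\<lambda>i. N * w i)(b := x)) i = 0" using supp by simp
  then have eq: "(\<lambda>i. N * w i)(b := x) = (\<lambda>_. 0)"
    using pointed N(2) unfolding pointed_on_def by blast
  have "w i = 0" for i
    using fun_cong[OF eq, of i] supp b N(1) by (cases "i = b") auto
  then show "w = (\<lambda>_. 0)" by blast
qed

text \<open>The finite sum is grouped by lines in direction \<open>b\<close>; resetting coordinate
  \<open>b\<close> to \<open>z b\<close> picks the representative of each line in
  \<open>fibre_off B z\<close>. All other lines miss the cone and contribute empty sums.\<close>

lemma sum_lattice_cone_fibre:
  assumes b: "b \<notin> B" and fin: "finite (lattice_cone F \<inter> fibre_off (insert b B) z)"
  shows "(line_sum b F q has_sum (\<Sum>w\<in>lattice_cone F \<inter> fibre_off (insert b B) z. q w)) (fibre_off B z)"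
proof -
  define S where "S = lattice_cone F \<inter> fibre_off (insert b B) z"
  define T where "T = (\<lambda>w. w(b := z b)) ` S"
  have fin_S: "finite S" using fin by (simp add: S_def)
  have "(\<Sum>w\<in>S. q w) = (\<Sum>w'\<in>T. \<Sum>w\<in>{w \<in> S. w(b := z b) = w'}. q w)"
    unfolding T_def by (rule sum.image_gen[OF fin_S])
  also have "\<dots> = (\<Sum>w'\<in>T. line_sum b F q w')"
  proof (intro sum.cong refl)
    fix w' assume "w' \<in> T"
    then have w': "w' \<in> fibre_off B z" using b by (auto simp: T_def S_def fibre_off_def)
    show "(\<Sum>w\<in>{w \<in> S. w(b := z b) = w'}. q w) = line_sum b F q w'"
      unfolding line_sum_def
    proof (rule sum.reindex_bij_witness[where i = "\<lambda>x. w'(b := x)" and j = "\<lambda>w. w b"])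
      fix w assume "w \<in> {w \<in> S. w(b := z b) = w'}"
      then show "w'(b := w b) = w" "w b \<in> {x. w'(b := x) \<in> lattice_cone F}" "q (w'(b := w b)) = q w"
        by (auto simp: S_def)
    next
      fix x assume "x \<in> {x. w'(b := x) \<in> lattice_cone F}"
      moreover have "w'(b := z b) = w'" using w' b by (auto simp: fibre_off_def)
      ultimately show "w'(b := x) \<in> {w \<in> S. w(b := z b) = w'}" "(w'(b := x)) b = x"
        using w' by (auto simp: S_def fibre_off_def)
    qed
  qed
  finally have eq: "(\<Sum>w\<in>S. q w) = (\<Sum>w'\<in>T. line_sum b F q w')" .
  show ?thesis
    unfolding S_def[symmetric] eq
  proof (rule has_sum_finite_neutralI)
    show "finite T" unfolding T_def using fin_S by simp
    show "T \<subseteq> fibre_off B z" using b by (auto simp: T_def S_def fibre_off_def)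
    fix w' assume w': "w' \<in> fibre_off B z - T"
    have "w'(b := x) \<notin> lattice_cone F" for x
    proof
      assume "w'(b := x) \<in> lattice_cone F"
      then have "w'(b := x) \<in> S" using w' by (auto simp: S_def fibre_off_def)
      moreover have "w' = (w'(b := x))(b := z b)" using w' b by (auto simp: fibre_off_def fun_eq_iff)
      ultimately have "w' \<in> T" unfolding T_def by (intro image_eqI)
      then show False using w' by blast
    qed
    then show "line_sum b F q w' = 0" by (simp add: line_sum_def)
  qed simp
qed

text \<open>Induction on \<open>B\<close>, summing out one coordinate at a time. The line sums live
  on cones inside the rational shadow of the previous cone, which is pointed for the remaining
  coordinates, so the induction hypothesis applies with a new \<open>A\<close>.\<close>

lemma fibre_has_sum:
  assumes "finite B" and "pointed_on B A" and "f \<in> cone_qpoly A"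
  shows "\<exists>G\<in>cone_qpoly UNIV. \<forall>z. (f has_sum G z) (fibre_off B z)"
  using assms
proof (induction B arbitrary: A f rule: finite_induct)
  case empty
  have "fibre_off {} z = {z}" for z :: "'a \<Rightarrow> int" by (auto simp: fibre_off_def fun_eq_iff)
  then have "\<forall>z. (f has_sum f z) (fibre_off {} z)"
    using has_sum_finite[of "{z}" f for z] by simp
  then show ?case using cone_qpoly_mono[OF empty(2)] by blast
next
  case (insert b B)
  from insert.prems(2) show ?case
  proof (induction rule: cone_qpoly.induct)
    case (cone F q)
    have pointed: "pointed_on (insert b B) (lattice_cone F)"
      using pointed_on_subset[OF insert.prems(1) cone(3)] .
    then have "pointed_on {b} (lattice_cone F)" unfolding pointed_on_def by blast
    then have "line_sum b F q \<in> cone_qpoly (rat_shadow b (lattice_cone F))"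
      using line_sum_cone_qpoly[OF cone(1,2,4)] by blast
    from insert.IH[OF pointed_on_rat_shadow[OF pointed insert.hyps(2)] this]
    obtain G where G: "G \<in> cone_qpoly UNIV"
      "\<And>z. (line_sum b F q has_sum G z) (fibre_off B z)" by blast
    have "((\<lambda>w. if w \<in> lattice_cone F then q w else 0) has_sum G z) (fibre_off (insert b B) z)" for z
    proof -
      have fin: "finite (lattice_cone F \<inter> fibre_off (insert b B) z)"
        by (rule finite_pointed_fibre[OF cone(1,2) pointed])
      have "G z = (\<Sum>w\<in>lattice_cone F \<inter> fibre_off (insert b B) z. q w)"
        by (rule has_sum_unique[OF G(2) sum_lattice_cone_fibre[OF insert.hyps(2) fin]])
      also have "\<dots> = (\<Sum>w\<in>lattice_cone F \<inter> fibre_off (insert b B) z.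
          if w \<in> lattice_cone F then q w else 0)"
        by (intro sum.cong) auto
      finally show ?thesis
        by (intro has_sum_finite_neutralI[OF fin]) auto
    qed
    then show ?case using G(1) by blast
  next
    case (add f g)
    then obtain G H where "G \<in> cone_qpoly UNIV" "H \<in> cone_qpoly UNIV"
      and "\<And>z. (f has_sum G z) (fibre_off (insert b B) z)"
      and "\<And>z. (g has_sum H z) (fibre_off (insert b B) z)" by blast
    then show ?case
      by (intro bexI[of _ "\<lambda>z. G z + H z"] allI has_sum_add cone_qpoly.add)
  qed
qed

section \<open>Sums over fibres of a cone with a recession direction\<close>

lemma qpoly_along_line:
  assumes "q \<in> qpoly"
  shows "\<exists>D>0. \<forall>E. D dvd E \<longrightarrow>
    (\<exists>p :: complex poly. \<forall>t. q (\<lambda>i. w i + E * (t * v i)) = poly p (of_int t))"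
  using assms
proof induction
  case (form l)
  have *: "\<exists>p :: complex poly. \<forall>t. of_int (l (\<lambda>i. w i + E * (t * v i))) = poly p (of_int t)" for E
    by (intro exI[of _ "[:of_int (l w), of_int (E * l v):]"])
      (simp add: additive_form_add[OF form] additive_form_scale[OF form])
  show ?case by (intro exI[of _ 1] conjI allI impI * zero_less_one)
next
  case (periodic D p)
  have *: "\<exists>r :: complex poly. \<forall>t. p (\<lambda>i. w i + E * (t * v i)) = poly r (of_int t)"
    if E: "D dvd E" for E
  proof (intro exI[of _ "[:p w:]"] allI)
    fix t
    from E obtain k where k: "E = D * k" by blast
    show "p (\<lambda>i. w i + E * (t * v i)) = poly [:p w:] (of_int t)"
      using periodic(2)[of w "\<lambda>i. k * (t * v i)"] by (simp add: k mult.assoc)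
  qed
  show ?case by (intro exI[of _ D] conjI allI impI periodic(1) *)
next
  case (add f g)
  from add.IH(1) obtain D1 where D1: "D1 > 0" and f: "\<forall>E. D1 dvd E \<longrightarrow>
    (\<exists>p :: complex poly. \<forall>t. f (\<lambda>i. w i + E * (t * v i)) = poly p (of_int t))" by (elim exE conjE)
  from add.IH(2) obtain D2 where D2: "D2 > 0" and g: "\<forall>E. D2 dvd E \<longrightarrow>
    (\<exists>p :: complex poly. \<forall>t. g (\<lambda>i. w i + E * (t * v i)) = poly p (of_int t))" by (elim exE conjE)
  have *: "\<exists>p :: complex poly. \<forall>t. f (\<lambda>i. w i + E * (t * v i)) + g (\<lambda>i. w i + E * (t * v i))
    = poly p (of_int t)" if E: "D1 * D2 dvd E" for E
  proof -
    obtain p1 p2 :: "complex poly" where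
      "\<And>t. f (\<lambda>i. w i + E * (t * v i)) = poly p1 (of_int t)"
      "\<And>t. g (\<lambda>i. w i + E * (t * v i)) = poly p2 (of_int t)"
      using f[rule_format, OF dvd_mult_left[OF E]] g[rule_format, OF dvd_mult_right[OF E]]
      by (elim exE) simp
    then show ?thesis by (intro exI[of _ "p1 + p2"]) simp
  qed
  show ?case by (intro exI[of _ "D1 * D2"] conjI allI impI mult_pos_pos[OF D1 D2] *)
next
  case (mult f g)
  from mult.IH(1) obtain D1 where D1: "D1 > 0" and f: "\<forall>E. D1 dvd E \<longrightarrow>
    (\<exists>p :: complex poly. \<forall>t. f (\<lambda>i. w i + E * (t * v i)) = poly p (of_int t))" by (elim exE conjE)
  from mult.IH(2) obtain D2 where D2: "D2 > 0" and g: "\<forall>E. D2 dvd E \<longrightarrow>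
    (\<exists>p :: complex poly. \<forall>t. g (\<lambda>i. w i + E * (t * v i)) = poly p (of_int t))" by (elim exE conjE)
  have *: "\<exists>p :: complex poly. \<forall>t. f (\<lambda>i. w i + E * (t * v i)) * g (\<lambda>i. w i + E * (t * v i))
    = poly p (of_int t)" if E: "D1 * D2 dvd E" for E
  proof -
    obtain p1 p2 :: "complex poly" where
      "\<And>t. f (\<lambda>i. w i + E * (t * v i)) = poly p1 (of_int t)"
      "\<And>t. g (\<lambda>i. w i + E * (t * v i)) = poly p2 (of_int t)"
      using f[rule_format, OF dvd_mult_left[OF E]] g[rule_format, OF dvd_mult_right[OF E]]
      by (elim exE) simp
    then show ?thesis by (intro exI[of _ "p1 * p2"]) simp
  qed
  show ?case by (intro exI[of _ "D1 * D2"] conjI allI impI mult_pos_pos[OF D1 D2] *)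
qed

text \<open>A nonconstant polynomial tends to infinity along the natural numbers, and a constant
  equals its limit.\<close>

lemma poly_vanishing_at_top:
  fixes p :: "complex poly"
  assumes "(\<lambda>n. poly p (of_nat n)) \<longlonglongrightarrow> 0"
  shows "p = 0"
proof -
  have "degree p = 0"
  proof (rule ccontr)
    assume "degree p \<noteq> 0"
    then have "filterlim (poly p) at_infinity at_infinity" by (intro filterlim_poly_at_infinity) simp
    then have "filterlim (\<lambda>n. poly p (of_nat n)) at_infinity sequentially"
      by (rule filterlim_compose) (rule tendsto_of_nat)
    then show False
      using assms not_tendsto_and_filterlim_at_infinity[OF sequentially_bot] by blast
  qed
  then obtain c where p: "p = [:c:]" by (rule degree_eq_zeroE)
  then have "(\<lambda>_ :: nat. c) \<longlonglongrightarrow> 0" using assms by simp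
  then show ?thesis using LIMSEQ_unique[OF tendsto_const] p by fastforce
qed

text \<open>From every cone point of the fibre a ray in direction \<open>v\<close> stays in the cone
  and the fibre, and \<open>q\<close> is a polynomial along it for a suitable step. Summability
  makes this polynomial tend to 0, hence vanish, so \<open>q\<close> is 0 at the starting point.
  Without summability the value 0 is the default of \<open>infsum\<close>.\<close>

lemma infsum_fibre_not_pointed:
  assumes F: "\<And>l. l \<in> F \<Longrightarrow> additive_form l" and q: "q \<in> qpoly"
    and not_pointed: "\<not> pointed_on B (lattice_cone F)"
  shows "(\<Sum>\<^sub>\<infinity>w\<in>fibre_off B z. if w \<in> lattice_cone F then q w else 0) = 0"
proof (cases "(\<lambda>w. if w \<in> lattice_cone F then q w else 0) summable_on fibre_off B z")
  case False
  then show ?thesis by (rule infsum_not_exists)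
next
  case True
  from not_pointed obtain v where v: "v \<in> lattice_cone F" "\<And>i. i \<notin> B \<Longrightarrow> v i = 0" "v \<noteq> (\<lambda>_. 0)"
    unfolding pointed_on_def by blast
  from v(3) obtain i0 where i0: "v i0 \<noteq> 0" by blast
  have "q w = 0" if w: "w \<in> fibre_off B z" "w \<in> lattice_cone F" for w
  proof -
    obtain D where D: "D > 0" and "\<forall>E. D dvd E \<longrightarrow>
      (\<exists>p :: complex poly. \<forall>t. q (\<lambda>i. w i + E * (t * v i)) = poly p (of_int t))"
      using qpoly_along_line[OF q, of w v] by (elim exE conjE)
    then obtain p :: "complex poly"
      where p: "\<forall>t. q (\<lambda>i. w i + D * (t * v i)) = poly p (of_int t)"
      using dvd_refl by blast
    define ray where "ray n = (\<lambda>i. w i + D * (int n * v i))" for n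
    have "inj ray"
    proof (rule injI)
      fix m n assume "ray m = ray n"
      from fun_cong[OF this, of i0] show "m = n" using i0 D by (simp add: ray_def)
    qed
    have cone: "ray n \<in> lattice_cone F" for n
    proof -
      have "l (ray n) \<le> 0" if l: "l \<in> F" for l
      proof -
        have "l (ray n) = l w + D * (int n * l v)"
          unfolding ray_def additive_form_add[OF F[OF l]] additive_form_scale[OF F[OF l]] ..
        moreover have "D * (int n * l v) \<le> 0"
          using D v(1) l by (auto simp: lattice_cone_def mult_le_0_iff)
        ultimately show ?thesis using w(2) l by (auto simp: lattice_cone_def)
      qed
      then show ?thesis by (simp add: lattice_cone_def)
    qed
    have "range ray \<subseteq> fibre_off B z" using w(1) v(2) by (auto simp: fibre_off_def ray_def)
    from summable_on_subset_banach[OF True this]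
    have "((\<lambda>w. if w \<in> lattice_cone F then q w else 0) \<circ> ray) summable_on UNIV"
      using summable_on_reindex[OF \<open>inj ray\<close>] by blast
    moreover have "(\<lambda>w. if w \<in> lattice_cone F then q w else 0) \<circ> ray = (\<lambda>n. poly p (of_nat n))"
    proof
      fix n show "((\<lambda>w. if w \<in> lattice_cone F then q w else 0) \<circ> ray) n = poly p (of_nat n)"
        using cone[of n] p[rule_format, of "int n"] by (simp add: ray_def)
    qed
    ultimately have "summable (\<lambda>n. poly p (of_nat n))"
      using summable_on_imp_summable by metis
    then have "p = 0" by (intro poly_vanishing_at_top summable_LIMSEQ_zero)
    then show ?thesis using p[rule_format, of 0] by simp
  qed
  then show ?thesis by (intro infsum_0) auto
qed

lemma fibre_infsum_cone_qpoly:
  assumes "finite B" and F: "finite F" "\<And>l. l \<in> F \<Longrightarrow> additive_form l" and q: "q \<in> qpoly"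
  shows "\<exists>G\<in>cone_qpoly UNIV. \<forall>z.
    (\<Sum>\<^sub>\<infinity>w\<in>fibre_off B z. if w \<in> lattice_cone F then q w else 0) = G z"
proof (cases "pointed_on B (lattice_cone F)")
  case True
  obtain G where "G \<in> cone_qpoly UNIV"
    and "\<And>z. ((\<lambda>w. if w \<in> lattice_cone F then q w else 0) has_sum G z) (fibre_off B z)"
    using fibre_has_sum[OF assms(1) True cone_qpoly.cone[OF F order_refl q]] by blast
  then show ?thesis by (intro bexI[of _ G] allI infsumI)
next
  case False
  \<comment> \<open>The empty set of forms cuts out the whole lattice, which exhibits the zero
    function as a member.\<close>
  have "(\<lambda>z. if z \<in> lattice_cone {} then 0 else 0 :: complex) \<in> cone_qpoly UNIV"
    by (rule cone_qpoly.cone) (auto intro: qpoly_const)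
  then have "(\<lambda>_. 0) \<in> cone_qpoly UNIV" by simp
  then show ?thesis
    by (intro bexI[of _ "\<lambda>_. 0"] allI infsum_fibre_not_pointed[OF F(2) q False])
qed

section \<open>Passage to lattices in Euclidean spaces\<close>

text \<open>Finitely many coordinates with their images are made explicit, so that rational
  coefficients have a common denominator.\<close>

definition int_linear :: "(('i \<Rightarrow> int) \<Rightarrow> 'v::real_vector) \<Rightarrow> bool" where
  "int_linear \<phi> \<longleftrightarrow> (\<exists>J v. finite J \<and> \<phi> = (\<lambda>z. \<Sum>i\<in>J. of_int (z i) *\<^sub>R v i))"

lemma int_linear_coord_sum:
  assumes "finite B" "inj_on f B"
  shows "int_linear (\<lambda>z. \<Sum>b\<in>B. of_int (z (f b)) *\<^sub>R (u b :: 'v::real_vector))"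
  unfolding int_linear_def
proof (intro exI conjI)
  show "finite (f ` B)" using assms(1) by simp
  show "(\<lambda>z. \<Sum>b\<in>B. of_int (z (f b)) *\<^sub>R u b)
      = (\<lambda>z. \<Sum>i\<in>f ` B. of_int (z i) *\<^sub>R (u (inv_into B f i)))"
    using assms by (simp add: sum.reindex)
qed

lemma int_linear_coord: "int_linear (\<lambda>z. of_int (z j) :: real)"
  using int_linear_coord_sum[of "{j}" "\<lambda>i. i" "\<lambda>_. 1 :: real"] by simp

lemma int_linear_compose:
  assumes g: "linear g" and \<phi>: "int_linear \<phi>"
  shows "int_linear (\<lambda>z. g (\<phi> z))"
proof -
  obtain J v where J: "finite J" and \<phi>_eq: "\<phi> = (\<lambda>z. \<Sum>i\<in>J. of_int (z i) *\<^sub>R v i)"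
    using \<phi> unfolding int_linear_def by blast
  have "(\<lambda>z. g (\<phi> z)) = (\<lambda>z. \<Sum>i\<in>J. of_int (z i) *\<^sub>R g (v i))"
    unfolding \<phi>_eq by (simp add: linear_sum[OF g] linear_cmul[OF g])
  then show ?thesis
    using J unfolding int_linear_def by (intro exI[of _ J] exI[of _ "\<lambda>i. g (v i)"] conjI)
qed

lemma int_linear_Pair:
  assumes "int_linear \<phi>" "int_linear \<phi>'"
  shows "int_linear (\<lambda>z. (\<phi> z, \<phi>' z))"
proof -
  obtain J v where J: "finite J" and \<phi>: "\<phi> = (\<lambda>z. \<Sum>i\<in>J. of_int (z i) *\<^sub>R v i)"
    using assms(1) unfolding int_linear_def by blast
  obtain J' v' where J': "finite J'" and \<phi>': "\<phi>' = (\<lambda>z. \<Sum>i\<in>J'. of_int (z i) *\<^sub>R v' i)"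
    using assms(2) unfolding int_linear_def by blast
  define u where "u i = (if i \<in> J then v i else 0, if i \<in> J' then v' i else 0)" for i
  have "(\<phi> z, \<phi>' z) = (\<Sum>i\<in>J \<union> J'. of_int (z i) *\<^sub>R u i)" for z
  proof -
    have "\<phi> z = (\<Sum>i\<in>J \<union> J'. of_int (z i) *\<^sub>R fst (u i))"
      unfolding \<phi> using J J' by (intro sum.mono_neutral_cong_left) (auto simp: u_def)
    moreover have "\<phi>' z = (\<Sum>i\<in>J \<union> J'. of_int (z i) *\<^sub>R snd (u i))"
      unfolding \<phi>' using J J' by (intro sum.mono_neutral_cong_left) (auto simp: u_def)
    ultimately show ?thesis by (simp add: prod_eq_iff fst_sum snd_sum)
  qed
  then show ?thesis
    using J J' unfolding int_linear_def
    by (intro exI[of _ "J \<union> J'"] exI[of _ u] conjI ext) simp_all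
qed

lemma int_linear_add_scale:
  assumes "int_linear \<phi>"
  shows "\<phi> (\<lambda>i. z i + n * w i) = \<phi> z + of_int n *\<^sub>R \<phi> w"
proof -
  obtain J v where "\<phi> = (\<lambda>z. \<Sum>i\<in>J. of_int (z i) *\<^sub>R v i)"
    using assms unfolding int_linear_def by blast
  then show ?thesis
    by (simp add: scaleR_add_left sum.distrib scaleR_sum_right)
qed

lemma common_denominator:
  fixes r :: "'i \<Rightarrow> real"
  assumes "finite J" "\<And>i. i \<in> J \<Longrightarrow> r i \<in> \<rat>"
  shows "\<exists>N>0. \<forall>i\<in>J. of_int N * r i \<in> \<int>"
  using assms
proof induction
  case empty
  show ?case by (intro exI[of _ 1]) simp
next
  case (insert j J)
  have "\<exists>N>0. \<forall>i\<in>J. of_int N * r i \<in> \<int>"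
    by (rule insert.IH) (use insert.prems in simp)
  then obtain N where N: "N > 0" "\<And>i. i \<in> J \<Longrightarrow> of_int N * r i \<in> \<int>" by blast
  obtain m n :: int where n: "n > 0" "r j = of_int m / of_int n"
    by (rule Rats_cases'[OF insert.prems[OF insertI1]])
  have "of_int (N * n) * r i \<in> \<int>" if "i \<in> insert j J" for i
  proof (cases "i = j")
    case True
    then have "of_int (N * n) * r i = of_int (N * m)" using n by simp
    then show ?thesis by (metis Ints_of_int)
  next
    case False
    then have "of_int n * (of_int N * r i) \<in> \<int>"
      using that by (intro Ints_mult[OF Ints_of_int N(2)]) simp
    then show ?thesis by (simp add: mult_ac)
  qed
  then show ?case using N(1) n(1) by (intro exI[of _ "N * n"]) auto
qed

lemma int_linear_unit_vec:
  assumes "finite J" "i \<in> J"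
  shows "(\<Sum>j\<in>J. of_int (unit_vec i j) *\<^sub>R v j) = (v i :: 'v::real_vector)"
proof -
  have "(\<Sum>j\<in>J. of_int (unit_vec i j) *\<^sub>R v j) = (\<Sum>j\<in>J. if j = i then v i else 0)"
    by (intro sum.cong) (auto simp: unit_vec_def)
  then show ?thesis using assms by simp
qed

text \<open>The coefficients are the values at unit vectors, hence rational. Multiplication by a
  positive common denominator gives an integral form with the same half-space.\<close>

lemma int_linear_rational_form:
  fixes \<phi> :: "('i \<Rightarrow> int) \<Rightarrow> real"
  assumes "int_linear \<phi>" and rat: "\<And>z. \<phi> z \<in> \<rat>"
  shows "\<exists>l. additive_form l \<and> (\<forall>z. l z \<le> 0 \<longleftrightarrow> \<phi> z \<le> 0)"
proof -
  obtain J v where J: "finite J" and \<phi>: "\<phi> = (\<lambda>z. \<Sum>i\<in>J. of_int (z i) *\<^sub>R v i)"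
    using assms(1) unfolding int_linear_def by blast
  have "v i \<in> \<rat>" if "i \<in> J" for i
    using rat[of "unit_vec i"] int_linear_unit_vec[OF J that, of v] by (simp add: \<phi>)
  from common_denominator[of J v, OF J this] obtain N where N: "N > 0" "\<And>i. i \<in> J \<Longrightarrow> of_int N * v i \<in> \<int>"
    by blast
  define m where "m i = \<lfloor>of_int N * v i\<rfloor>" for i
  have m: "of_int (m i) = of_int N * v i" if "i \<in> J" for i
    using N(2)[OF that] by (auto simp: m_def elim: Ints_cases)
  define l where "l z = (\<Sum>i\<in>J. z i * m i)" for z
  have l: "of_int (l z) = of_int N * \<phi> z" for z
    unfolding l_def \<phi> by (simp add: sum_distrib_left m mult_ac)
  have "l z \<le> 0 \<longleftrightarrow> \<phi> z \<le> 0" for z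
  proof -
    have "l z \<le> 0 \<longleftrightarrow> real_of_int (l z) \<le> 0" by simp
    also have "\<dots> \<longleftrightarrow> \<phi> z \<le> 0" unfolding l using N(1) by (simp add: mult_le_0_iff)
    finally show ?thesis .
  qed
  moreover have "additive_form l"
    unfolding additive_form_def l_def by (simp add: distrib_right sum.distrib)
  ultimately show ?thesis by blast
qed

lemma int_linear_rational_cone:
  assumes fin: "finite \<G>" and \<G>: "\<And>\<phi>. \<phi> \<in> \<G> \<Longrightarrow> int_linear \<phi> \<and> (\<forall>z. \<phi> z \<in> \<rat>)"
  shows "\<exists>F. finite F \<and> (\<forall>l\<in>F. additive_form l) \<and>
    lattice_cone F = {z. \<forall>\<phi>\<in>\<G>. \<phi> z \<le> (0::real)}"
proof -
  have "\<forall>\<phi>\<in>\<G>. \<exists>l. additive_form l \<and> (\<forall>z. l z \<le> 0 \<longleftrightarrow> \<phi> z \<le> 0)"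
    using int_linear_rational_form \<G> by (intro ballI) blast
  from bchoice[OF this] obtain L
    where L: "\<And>\<phi>. \<phi> \<in> \<G> \<Longrightarrow> additive_form (L \<phi>)" "\<And>\<phi> z. \<phi> \<in> \<G> \<Longrightarrow> L \<phi> z \<le> 0 \<longleftrightarrow> \<phi> z \<le> 0"
    by blast
  have "lattice_cone (L ` \<G>) = {z. \<forall>\<phi>\<in>\<G>. \<phi> z \<le> 0}"
    by (auto simp: lattice_cone_def L(2))
  then show ?thesis using L(1) fin by (intro exI[of _ "L ` \<G>"]) auto
qed

section \<open>Pulling quasi-polynomials back to integer coordinates\<close>

lemma qpoly_int_linear:
  fixes \<phi> :: "('i \<Rightarrow> int) \<Rightarrow> real"
  assumes "int_linear \<phi>"
  shows "(\<lambda>z. of_real (\<phi> z)) \<in> qpoly"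
proof -
  obtain J v where J: "finite J" and \<phi>: "\<phi> = (\<lambda>z. \<Sum>i\<in>J. of_int (z i) *\<^sub>R v i)"
    using assms unfolding int_linear_def by blast
  have "(\<lambda>z. of_int (z i) * of_real (v i)) \<in> qpoly" for i
  proof (rule qpoly.mult[OF _ qpoly_const])
    have "additive_form (\<lambda>z. z i)" by (simp add: additive_form_def)
    from qpoly.form[OF this] show "(\<lambda>z. of_int (z i)) \<in> qpoly" .
  qed
  then have "(\<lambda>z. \<Sum>i\<in>J. of_int (z i) * of_real (v i)) \<in> qpoly" by (rule qpoly_sum)
  then show ?thesis by (simp add: \<phi>)
qed

lemma qpoly_real_polynomial:
  fixes g :: "'v::euclidean_space \<Rightarrow> real"
  assumes "real_polynomial_function g" and \<phi>: "int_linear \<phi>"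
  shows "(\<lambda>z. of_real (g (\<phi> z))) \<in> qpoly"
  using assms(1)
proof (induction rule: real_polynomial_function.induct)
  case (linear g)
  show ?case
    by (rule qpoly_int_linear[OF int_linear_compose[OF bounded_linear.linear[OF linear] \<phi>]])
next
  case (const c)
  show ?case by (rule qpoly_const)
next
  case (add f g)
  then show ?case using qpoly.add[OF add.IH] by simp
next
  case (mult f g)
  then show ?case using qpoly.mult[OF mult.IH] by simp
qed

text \<open>A complex polynomial is split into real and imaginary parts, whose pullbacks are built
  from real linear functionals. A period \<open>D\<close> on \<open>L\<close> remains a period in
  coordinates because the coordinate map is additive.\<close>

lemma qpoly_pullback:
  fixes \<phi> :: "('i \<Rightarrow> int) \<Rightarrow> 'v::euclidean_space"
  assumes "f \<in> quasi_polynomials L" and \<phi>: "int_linear \<phi>" "\<And>z. \<phi> z \<in> L"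
  shows "(\<lambda>z. f (\<phi> z)) \<in> qpoly"
  using assms(1)
proof induction
  case (poly f)
  then obtain p where p: "polynomial_function p" "\<And>x. x \<in> L \<Longrightarrow> f x = p x"
    unfolding polynomial_on_def by blast
  have "real_polynomial_function (Re \<circ> p)" "real_polynomial_function (Im \<circ> p)"
    using p(1) bounded_linear_Re bounded_linear_Im by (simp_all add: polynomial_function_def)
  note qpoly_real_polynomial[OF this(1) \<phi>(1)] qpoly_real_polynomial[OF this(2) \<phi>(1)]
  then have "(\<lambda>z. of_real (Re (p (\<phi> z)))) \<in> qpoly"
    and im: "(\<lambda>z. of_real (Im (p (\<phi> z)))) \<in> qpoly"
    by (simp_all add: o_def)
  from qpoly.add[OF this(1) qpoly.mult[OF qpoly_const[of "\<i>"] im]]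
  have "(\<lambda>z. of_real (Re (p (\<phi> z))) + \<i> * of_real (Im (p (\<phi> z)))) \<in> qpoly" .
  also have "(\<lambda>z. of_real (Re (p (\<phi> z))) + \<i> * of_real (Im (p (\<phi> z)))) = (\<lambda>z. f (\<phi> z))"
    by (rule ext) (simp only: p(2)[OF \<phi>(2)] complex_eq[symmetric])
  finally show ?case .
next
  case (periodic f)
  then obtain D :: nat where D: "D > 0" "\<forall>x0\<in>L. \<forall>x\<in>L. f (x0 + real D *\<^sub>R x) = f x0"
    unfolding periodic_on_def by blast
  show ?case
  proof (rule qpoly.periodic[of "int D"])
    fix z w show "f (\<phi> (\<lambda>i. z i + int D * w i)) = f (\<phi> z)"
      using D(2) \<phi>(2) by (simp add: int_linear_add_scale[OF \<phi>(1)])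
  qed (use D in simp)
next
  case (add f g)
  show ?case by (rule qpoly.add[OF add.IH])
next
  case (mult f g)
  show ?case by (rule qpoly.mult[OF mult.IH])
qed

section \<open>From integer coordinates back to the target lattice\<close>

text \<open>
  Coordinates of \<open>(\<mu>, k)\<close>, with zeros for the coordinates of \<open>\<lambda>\<close>: the index \<open>None\<close> stands for \<open>k\<close>,
  \<open>Some (Inl b)\<close> and \<open>Some (Inr b)\<close> for the basis vectors of the two lattices. The floor only
  converts types, since all values are integral on the lattice.
\<close>
definition lattice_section ::
  "'b set \<Rightarrow> ('b \<Rightarrow> 'b \<Rightarrow> real) \<Rightarrow> 'b \<times> real \<Rightarrow> ('a + 'b) option \<Rightarrow> int" where
  "lattice_section B \<beta> x i = (case i of None \<Rightarrow> \<lfloor>snd x\<rfloor> | Some (Inl _) \<Rightarrow> 0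
     | Some (Inr b) \<Rightarrow> if b \<in> B then \<lfloor>\<beta> b (fst x)\<rfloor> else 0)"

lemma lattice_section_simps:
  "lattice_section B \<beta> x None = \<lfloor>snd x\<rfloor>"
  "lattice_section B \<beta> x (Some (Inl a)) = 0"
  "lattice_section B \<beta> x (Some (Inr b)) = (if b \<in> B then \<lfloor>\<beta> b (fst x)\<rfloor> else 0)"
  by (simp_all add: lattice_section_def)

context
  fixes B L :: "'b::euclidean_space set" and \<beta> :: "'b \<Rightarrow> 'b \<Rightarrow> real"
  assumes fin: "finite B" and \<beta>: "\<And>b. linear (\<beta> b)"
    and \<beta>_Ints: "\<And>b x. b \<in> B \<Longrightarrow> x \<in> L \<Longrightarrow> \<beta> b x \<in> \<int>"
begin

text \<open>The floors leave integral values unchanged, so on the lattice the form becomes a real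
  linear expression in \<open>x\<close> and \<open>k\<close>. Its sign condition is what defines a
  polyhedron later.\<close>

lemma additive_form_lattice_section:
  fixes l :: "(('a + 'b) option \<Rightarrow> int) \<Rightarrow> int"
  assumes l: "additive_form l" and x: "x \<in> L" and k: "k \<in> \<int>"
  shows "of_int (l (lattice_section B \<beta> (x, k)))
    = (\<Sum>b\<in>B. \<beta> b x * of_int (l (unit_vec (Some (Inr b))))) + k * of_int (l (unit_vec None))"
proof -
  let ?J = "insert None ((\<lambda>b. Some (Inr b)) ` B)"
  let ?z = "lattice_section B \<beta> (x, k) :: ('a + 'b) option \<Rightarrow> int"
  have "?z i = 0" if "i \<notin> ?J" for i
  proof (cases i)
    case None
    then show ?thesis using that by simp
  next
    case (Some c)
    then show ?thesis using that by (cases c) (auto simp: lattice_section_simps)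
  qed
  then have "l ?z = (\<Sum>i\<in>?J. ?z i * l (unit_vec i))"
    using fin by (intro additive_form_support[OF l]) simp_all
  also have "\<dots> = \<lfloor>k\<rfloor> * l (unit_vec None)
      + (\<Sum>i\<in>(\<lambda>b. Some (Inr b)) ` B. ?z i * l (unit_vec i))"
    using fin by (subst sum.insert) (auto simp: lattice_section_simps)
  also have "(\<Sum>i\<in>(\<lambda>b. Some (Inr b)) ` B. ?z i * l (unit_vec i))
      = (\<Sum>b\<in>B. \<lfloor>\<beta> b x\<rfloor> * l (unit_vec (Some (Inr b))))"
    by (subst sum.reindex) (simp_all add: inj_on_def lattice_section_simps)
  finally have "real_of_int (l ?z) = of_int \<lfloor>k\<rfloor> * of_int (l (unit_vec None))
      + (\<Sum>b\<in>B. of_int \<lfloor>\<beta> b x\<rfloor> * of_int (l (unit_vec (Some (Inr b)))))"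
    by simp
  moreover have "of_int \<lfloor>k\<rfloor> = k" by (rule Ints_cases[OF k]) simp
  moreover have "of_int \<lfloor>\<beta> b x\<rfloor> = \<beta> b x" if "b \<in> B" for b
    by (rule Ints_cases[OF \<beta>_Ints[OF that x]]) simp
  ultimately show ?thesis by (simp cong: sum.cong)
qed

text \<open>Forms become restrictions of linear functions. Periodicity survives because the section
  is additive on lattice points, where every floor is taken of an integer.\<close>

lemma quasi_polynomials_lattice_section:
  fixes q :: "(('a + 'b) option \<Rightarrow> int) \<Rightarrow> complex"
  assumes "q \<in> qpoly"
  shows "(\<lambda>x. q (lattice_section B \<beta> x)) \<in> quasi_polynomials (L \<times> \<int>)"
  using assms
proof induction
  case (form l)
  define g where "g x = (\<Sum>b\<in>B. \<beta> b (fst x) * of_int (l (unit_vec (Some (Inr b)))))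
    + snd x * of_int (l (unit_vec None))" for x :: "'b \<times> real"
  have "linear (\<lambda>x. complex_of_real (g x))"
    by (rule linearI)
      (simp_all add: g_def linear_add[OF \<beta>] linear_cmul[OF \<beta>] algebra_simps sum.distrib
        sum_distrib_left scaleR_conv_of_real)
  then have "polynomial_function (\<lambda>x. complex_of_real (g x))"
    by (intro polynomial_function_bounded_linear) (simp add: linear_conv_bounded_linear)
  moreover have "of_int (l (lattice_section B \<beta> x)) = complex_of_real (g x)" if "x \<in> L \<times> \<int>" for x
  proof -
    have "real_of_int (l (lattice_section B \<beta> x)) = g x"
      using additive_form_lattice_section[OF form, of "fst x" "snd x"] that by (auto simp: g_def)
    then show ?thesis by (metis of_real_of_int_eq)
  qed
  ultimately show ?case
    by (intro quasi_polynomials.poly) (auto simp: polynomial_on_def)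
next
  case (periodic D p)
  show ?case
  proof (rule quasi_polynomials.periodic)
    show "periodic_on (L \<times> \<int>) (\<lambda>x. p (lattice_section B \<beta> x))"
      unfolding periodic_on_def
    proof (intro exI[of _ "nat D"] conjI ballI)
      fix x0 x :: "'b \<times> real" assume x: "x0 \<in> L \<times> \<int>" "x \<in> L \<times> \<int>"
      have x_mem: "fst x0 \<in> L" "snd x0 \<in> \<int>" "fst x \<in> L" "snd x \<in> \<int>" using x by auto
      have D: "real (nat D) = of_int D" using periodic(1) by simp
      have floor: "\<lfloor>s + of_int D * t\<rfloor> = \<lfloor>s\<rfloor> + D * \<lfloor>t\<rfloor>" if "s \<in> \<int>" "t \<in> \<int>" for s t :: real
      proof -
        obtain m n where st: "s = of_int m" "t = of_int n" using \<open>s \<in> \<int>\<close> \<open>t \<in> \<int>\<close> by (elim Ints_cases)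
        then have "s + of_int D * t = of_int (m + D * n)" by simp
        then show ?thesis unfolding st by (simp only: floor_of_int)
      qed
      have "lattice_section B \<beta> (x0 + real (nat D) *\<^sub>R x)
          = (\<lambda>i :: ('a + 'b) option. lattice_section B \<beta> x0 i + D * lattice_section B \<beta> x i)"
      proof
        fix i
        show "lattice_section B \<beta> (x0 + real (nat D) *\<^sub>R x) i
            = lattice_section B \<beta> x0 i + D * lattice_section B \<beta> x i"
        proof (cases i)
          case None
          then show ?thesis using floor[OF x_mem(2,4)] by (simp add: lattice_section_simps D)
        next
          case (Some c)
          then show ?thesis
            using floor[OF \<beta>_Ints[OF _ x_mem(1)] \<beta>_Ints[OF _ x_mem(3)]]
            by (cases c) (simp_all add: lattice_section_simps D linear_add[OF \<beta>] linear_cmul[OF \<beta>])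
        qed
      qed
      then show "p (lattice_section B \<beta> (x0 + real (nat D) *\<^sub>R x)) = p (lattice_section B \<beta> x0)"
        using periodic(2)[of "lattice_section B \<beta> x0" "lattice_section B \<beta> x"] by simp
    qed (use periodic in simp)
  qed
next
  case (add f g)
  show ?case by (rule quasi_polynomials.add[OF add.IH])
next
  case (mult f g)
  show ?case by (rule quasi_polynomials.mult[OF mult.IH])
qed

end

section \<open>Elements of \<open>S_space\<close> and homogenised polyhedra\<close>

lemma S_space_add:
  fixes L :: "'a::euclidean_space set"
  assumes "s \<in> S_space V L" "t \<in> S_space V L"
  shows "(\<lambda>x. s x + t x) \<in> S_space V L"
proof -
  obtain N :: nat and a q P where s:
    "\<forall>i<N. rational_polyhedron V L (P i) \<and> q i \<in> quasi_polynomials (L \<times> \<int>)"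
    "\<forall>x \<in> L \<times> \<int>. s x = (\<Sum>i<N. a i * cut_off (q i) (P i) x)"
    using assms(1) unfolding S_space_def by blast
  obtain M :: nat and b r Q where t:
    "\<forall>i<M. rational_polyhedron V L (Q i) \<and> r i \<in> quasi_polynomials (L \<times> \<int>)"
    "\<forall>x \<in> L \<times> \<int>. t x = (\<Sum>i<M. b i * cut_off (r i) (Q i) x)"
    using assms(2) unfolding S_space_def by blast
  define c where "c i = (if i < N then a i else b (i - N))" for i
  define u where "u i = (if i < N then q i else r (i - N))" for i
  define R where "R i = (if i < N then P i else Q (i - N))" for i
  have "\<forall>i<N + M. rational_polyhedron V L (R i) \<and> u i \<in> quasi_polynomials (L \<times> \<int>)"
    using s(1) t(1) by (auto simp: u_def R_def)
  moreover have "\<forall>x \<in> L \<times> \<int>. s x + t x = (\<Sum>i<N + M. c i * cut_off (u i) (R i) x)"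
  proof
    fix x :: "'a \<times> real" assume x: "x \<in> L \<times> \<int>"
    have "(\<Sum>i<N + M. c i * cut_off (u i) (R i) x)
        = (\<Sum>i<N. c i * cut_off (u i) (R i) x) + (\<Sum>i<M. c (N + i) * cut_off (u (N + i)) (R (N + i)) x)"
      by (induction M) (simp_all add: add.assoc)
    also have "\<dots> = s x + t x"
      unfolding s(2)[rule_format, OF x] t(2)[rule_format, OF x]
      by (intro arg_cong2[of _ _ _ _ "(+)"] sum.cong) (auto simp: c_def u_def R_def)
    finally show "s x + t x = (\<Sum>i<N + M. c i * cut_off (u i) (R i) x)" ..
  qed
  ultimately show ?thesis unfolding S_space_def mem_Collect_eq
    by (intro exI[of _ "N + M"] exI[of _ c] exI[of _ u] exI[of _ R] conjI)
qed

lemma cut_off_in_S_space: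
  assumes "rational_polyhedron V L P" "q \<in> quasi_polynomials (L \<times> \<int>)"
  shows "cut_off q P \<in> S_space V L"
  unfolding S_space_def mem_Collect_eq
  by (intro exI[of _ 1] exI[of _ "\<lambda>_. 1"] exI[of _ "\<lambda>_. q"] exI[of _ "\<lambda>_. P"] conjI)
    (use assms in auto)

lemma cone_over_pos_iff:
  assumes "t > 0"
  shows "(x, t) \<in> cone_over P \<longleftrightarrow> (1 / t) *\<^sub>R x \<in> P"
proof
  assume "(x, t) \<in> cone_over P"
  then obtain \<xi> where "x = t *\<^sub>R \<xi>" "\<xi> \<in> P" by (auto simp: cone_over_def)
  then show "(1 / t) *\<^sub>R x \<in> P" using assms by simp
next
  assume "(1 / t) *\<^sub>R x \<in> P"
  moreover have "x = t *\<^sub>R ((1 / t) *\<^sub>R x)" using assms by simp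
  ultimately show "(x, t) \<in> cone_over P" using assms unfolding cone_over_def
    by (intro CollectI exI[of _ t] exI[of _ "(1 / t) *\<^sub>R x"]) simp
qed

lemma cone_over_neg: "t < 0 \<Longrightarrow> (x, t) \<notin> cone_over P"
  by (auto simp: cone_over_def)

text \<open>Multiplying the inequalities for \<open>x / t\<close> by \<open>t\<close> makes them
  homogeneous. At \<open>t = 0\<close> they would read \<open>l x \<le> 0\<close>, whereas the cone
  over a polyhedron has at most the origin there.\<close>

lemma cone_over_polyhedron_iff:
  assumes "t > 0" "x \<in> V" "subspace V" and lin: "\<And>l a. (l, a) \<in> F \<Longrightarrow> linear l"
  shows "(x, t) \<in> cone_over {y \<in> V. \<forall>(l, a)\<in>F. l y \<le> a} \<longleftrightarrow> (\<forall>(l, a)\<in>F. l x - a * t \<le> 0)"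
proof -
  have "l ((1 / t) *\<^sub>R x) \<le> a \<longleftrightarrow> l x - a * t \<le> 0" if "(l, a) \<in> F" for l a
  proof -
    have "l ((1 / t) *\<^sub>R x) = l x / t" using linear_cmul[OF lin[OF that], of "1 / t" x] by simp
    then show ?thesis using assms(1) by (simp add: pos_divide_le_eq)
  qed
  moreover have "(1 / t) *\<^sub>R x \<in> V" using assms by (simp add: subspace_scale)
  ultimately show ?thesis unfolding cone_over_pos_iff[OF assms(1)] by auto
qed

text \<open>If \<open>l x\<close> were positive, a multiple of \<open>x\<close> with
  \<open>l\<close>-value \<open>\<bar>a\<bar> + 1\<close> would leave the polyhedron but not the
  cone. Conversely, the origin forces every bound \<open>a\<close> to be nonnegative.\<close>

lemma cone_polyhedron_homogeneous:
  fixes F :: "(('v::real_vector \<Rightarrow> real) \<times> real) set"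
  assumes "cone C" "0 \<in> C" and C: "C = {x \<in> V. \<forall>(l, a)\<in>F. l x \<le> a}"
    and lin: "\<And>l a. (l, a) \<in> F \<Longrightarrow> linear l"
  shows "C = {x \<in> V. \<forall>(l, a)\<in>F. l x \<le> 0}"
proof (intro equalityI subsetI)
  fix x assume x: "x \<in> C"
  have "l x \<le> 0" if la: "(l, a) \<in> F" for l a
  proof (rule ccontr)
    assume pos: "\<not> l x \<le> 0"
    define s where "s = (\<bar>a\<bar> + 1) / l x"
    have "s *\<^sub>R x \<in> C" using assms(1) x pos by (simp add: cone_def s_def)
    then have "l (s *\<^sub>R x) \<le> a" using la unfolding C by auto
    then have "\<bar>a\<bar> + 1 \<le> a"
      using pos by (simp add: linear_cmul[OF lin[OF la]] s_def)
    then show False by simp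
  qed
  then show "x \<in> {x \<in> V. \<forall>(l, a)\<in>F. l x \<le> 0}" using x unfolding C by auto
next
  fix x assume x: "x \<in> {x \<in> V. \<forall>(l, a)\<in>F. l x \<le> 0}"
  have "0 \<le> a" if "(l, a) \<in> F" for l a
    using assms(2) that linear_0[OF lin[OF that]] unfolding C by auto
  then have "\<forall>(l, a)\<in>F. l x \<le> a" using x by (auto intro: order_trans)
  then show "x \<in> C" using x unfolding C by blast
qed

text \<open>The functionals \<open>\<beta> b\<close> are the dual basis of \<open>B\<close>,
  extended to linear maps on the whole Euclidean space.\<close>

lemma lattice_in_coordinates:
  assumes "lattice_in V L"
  obtains B \<beta> where "finite B" "subspace V" "L \<subseteq> V" "\<And>b. linear (\<beta> b)"
    "L = range (\<lambda>n :: 'a::euclidean_space \<Rightarrow> int. \<Sum>b\<in>B. of_int (n b) *\<^sub>R b)"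
    "\<And>b n. b \<in> B \<Longrightarrow> \<beta> b (\<Sum>b\<in>B. of_int (n b) *\<^sub>R b) = (of_int (n b) :: real)"
proof -
  obtain B where B: "independent B" "span B = V"
    and L: "L = {(\<Sum>b\<in>B. of_int (n b) *\<^sub>R b) | n :: 'a \<Rightarrow> int. True}"
    using assms unfolding lattice_in_def by blast
  have fin: "finite B" using B(1) by (rule finiteI_independent)
  have "\<forall>b. \<exists>g. linear g \<and> (\<forall>b'\<in>B. g b' = (if b' = b then 1 else 0 :: real))"
    by (intro allI linear_independent_extend B(1))
  from choice[OF this] obtain \<beta> :: "'a \<Rightarrow> 'a \<Rightarrow> real"
    where *: "\<forall>b. linear (\<beta> b) \<and> (\<forall>b'\<in>B. \<beta> b b' = (if b' = b then 1 else 0))" ..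
  have \<beta>: "linear (\<beta> b)" "b' \<in> B \<Longrightarrow> \<beta> b b' = (if b' = b then 1 else 0)" for b b'
    using * by simp_all
  show ?thesis
  proof (rule that[OF fin])
    show "subspace V" unfolding B(2)[symmetric] by (rule subspace_span)
    have "(\<Sum>b\<in>B. of_int (n b) *\<^sub>R b) \<in> span B" for n :: "'a \<Rightarrow> int"
      by (intro span_sum span_scale span_base)
    then show "L \<subseteq> V" unfolding L B(2) by blast
    show "L = range (\<lambda>n :: 'a \<Rightarrow> int. \<Sum>b\<in>B. of_int (n b) *\<^sub>R b)" unfolding L by blast
    fix b and n :: "'a \<Rightarrow> int" assume b: "b \<in> B"
    have "\<beta> b (\<Sum>b\<in>B. of_int (n b) *\<^sub>R b) = (\<Sum>b'\<in>B. of_int (n b') * \<beta> b b')"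
      by (simp add: linear_sum[OF \<beta>(1)] linear_cmul[OF \<beta>(1)])
    also have "\<dots> = (\<Sum>b'\<in>B. if b' = b then of_int (n b) else 0)"
      by (intro sum.cong) (auto simp: \<beta>(2))
    finally show "\<beta> b (\<Sum>b\<in>B. of_int (n b) *\<^sub>R b) = of_int (n b)" using fin b by simp
  qed (rule \<beta>(1))
qed

text \<open>For \<open>k > 0\<close> a homogeneous cone in \<open>(\<mu>, k)\<close> is the cone
  over its slice at height 1, so each piece becomes a \<open>cut_off\<close>. For
  \<open>k < 0\<close> every cut-off function is 0, which the value on the right matches.\<close>

lemma cone_qpoly_lattice_section:
  fixes L V :: "'b::euclidean_space set" and G :: "(('a + 'b) option \<Rightarrow> int) \<Rightarrow> complex"
  assumes V: "subspace V" "L \<subseteq> V" and fin: "finite B" and \<beta>: "\<And>b. linear (\<beta> b)"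
    and \<beta>_Ints: "\<And>b x. b \<in> B \<Longrightarrow> x \<in> L \<Longrightarrow> \<beta> b x \<in> \<int>"
    and G: "G \<in> cone_qpoly A"
  shows "\<exists>s\<in>S_space V L. \<forall>\<mu>\<in>L. \<forall>k\<in>\<int>. k \<noteq> 0 \<longrightarrow>
    s (\<mu>, k) = (if k > 0 then G (lattice_section B \<beta> (\<mu>, k)) else 0)"
  using G
proof induction
  case (cone F q)
  define m where "m l x = (\<Sum>b\<in>B. \<beta> b x * of_int (l (unit_vec (Some (Inr b)))))"
    for l :: "(('a + 'b) option \<Rightarrow> int) \<Rightarrow> int" and x
  \<comment> \<open>Putting \<open>k = 1\<close> in the inequality of \<open>l\<close> and moving
    the coefficient of \<open>k\<close> to the right gives the bound; \<open>P\<close> below is the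
    slice at height 1.\<close>
  define H where "H = (\<lambda>l. (m l, - real_of_int (l (unit_vec None)))) ` F"
  define P where "P = {x \<in> V. \<forall>(l, a)\<in>H. l x \<le> a}"
  have lin: "linear (m l)" for l
    by (rule linearI)
      (simp_all add: m_def linear_add[OF \<beta>] linear_cmul[OF \<beta>] distrib_right sum.distrib
        sum_distrib_left mult.assoc)
  have "rational_polyhedron V L P"
    unfolding rational_polyhedron_def
  proof (intro exI[of _ H] conjI)
    show "finite H" using cone(1) by (simp add: H_def)
    have "m l x \<in> \<rat>" if "x \<in> L" for l x
      using \<beta>_Ints[OF _ that] Ints_subset_Rats unfolding m_def
      by (intro Rats_sum Rats_mult) (auto simp: subset_iff)
    then show "\<forall>(l, a)\<in>H. linear l \<and> l ` L \<subseteq> \<rat> \<and> a \<in> \<rat>"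
      using lin by (auto simp: H_def)
    show "P = {x \<in> V. \<forall>(l, a)\<in>H. l x \<le> a}" by (rule P_def)
  qed
  then have S: "cut_off (\<lambda>x. q (lattice_section B \<beta> x)) P \<in> S_space V L"
    by (rule cut_off_in_S_space)
      (rule quasi_polynomials_lattice_section[OF fin \<beta> \<beta>_Ints cone(4)])
  have "(\<mu>, k) \<in> cone_over P \<longleftrightarrow> lattice_section B \<beta> (\<mu>, k) \<in> lattice_cone F"
    if "\<mu> \<in> L" "k \<in> \<int>" "k > 0" for \<mu> k
  proof -
    have "l (lattice_section B \<beta> (\<mu>, k)) \<le> 0 \<longleftrightarrow> m l \<mu> \<le> - (of_int (l (unit_vec None)) * k)"
      if "l \<in> F" for l
    proof -
      have "l (lattice_section B \<beta> (\<mu>, k)) \<le> 0 \<longleftrightarrow> real_of_int (l (lattice_section B \<beta> (\<mu>, k))) \<le> 0"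
        by simp
      also have "real_of_int (l (lattice_section B \<beta> (\<mu>, k))) = m l \<mu> + k * of_int (l (unit_vec None))"
        unfolding m_def
        by (rule additive_form_lattice_section[OF fin \<beta> \<beta>_Ints cone(2)[OF that] \<open>\<mu> \<in> L\<close> \<open>k \<in> \<int>\<close>])
      finally show ?thesis by (simp only: mult.commute[of k]) linarith
    qed
    moreover have "(\<mu>, k) \<in> cone_over P \<longleftrightarrow> (\<forall>(l, a)\<in>H. l \<mu> - a * k \<le> 0)"
      unfolding P_def using that V lin
      by (intro cone_over_polyhedron_iff) (auto simp: H_def)
    ultimately show ?thesis unfolding H_def lattice_cone_def by simp
  qed
  moreover have "(\<mu>, k) \<notin> cone_over P" if "\<not> k > 0" "k \<noteq> 0" for \<mu> k
    by (rule cone_over_neg) (use that in simp)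
  ultimately show ?case
    by (intro bexI[OF _ S] ballI impI) (simp add: cut_off_def)
next
  case (add f g)
  then obtain s t where st: "s \<in> S_space V L" "t \<in> S_space V L"
    "\<And>\<mu> k. \<mu> \<in> L \<Longrightarrow> k \<in> \<int> \<Longrightarrow> k \<noteq> 0 \<Longrightarrow>
      s (\<mu>, k) = (if k > 0 then f (lattice_section B \<beta> (\<mu>, k)) else 0)"
    "\<And>\<mu> k. \<mu> \<in> L \<Longrightarrow> k \<in> \<int> \<Longrightarrow> k \<noteq> 0 \<Longrightarrow>
      t (\<mu>, k) = (if k > 0 then g (lattice_section B \<beta> (\<mu>, k)) else 0)"
    by blast
  show ?case
    by (intro bexI[OF _ S_space_add[OF st(1,2)]]) (simp add: st(3,4))
qed

section \<open>The push-forward as a fibre sum in integer coordinates\<close>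

theorem proposition2p1:
  fixes V0 \<Lambda>0 P :: "'a::euclidean_space set"
    and V1 \<Lambda>1 :: "'b::euclidean_space set"
    and C01 :: "('a \<times> 'b) set"
    and qP :: "'a \<times> real \<Rightarrow> complex"
    and c :: "'a \<times> 'b \<Rightarrow> complex"
  assumes "lattice_in V0 \<Lambda>0" and "lattice_in V1 \<Lambda>1"
    and "rational_cone (V0 \<times> V1) (\<Lambda>0 \<times> \<Lambda>1) C01"
    and "rational_polyhedron V0 \<Lambda>0 P"
    and "\<And>\<mu>. \<mu> \<in> \<Lambda>1 \<Longrightarrow> compact (P \<inter> fibre V0 C01 \<mu>)"
    and "qP \<in> quasi_polynomials (\<Lambda>0 \<times> \<int>)"
    and "c \<in> quasi_polynomials (\<Lambda>0 \<times> \<Lambda>1)"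
  shows "\<exists>s \<in> S_space V1 \<Lambda>1. \<forall>\<mu>\<in>\<Lambda>1. \<forall>k\<in>\<int>. k \<noteq> 0 \<longrightarrow>
           push_sum \<Lambda>0 C01 (cut_off qP P) c (\<mu>, k) = s (\<mu>, k)"
proof -
  obtain B0 \<beta>0 where fin0: "finite B0" and V0: "subspace V0" "\<Lambda>0 \<subseteq> V0"
    and lin0: "\<And>b. linear (\<beta>0 b)"
    and \<Lambda>0: "\<Lambda>0 = range (\<lambda>n :: 'a \<Rightarrow> int. \<Sum>b\<in>B0. of_int (n b) *\<^sub>R b)"
    and \<beta>0: "\<And>b n. b \<in> B0 \<Longrightarrow> \<beta>0 b (\<Sum>b\<in>B0. of_int (n b) *\<^sub>R b) = (of_int (n b) :: real)"
    by (rule lattice_in_coordinates[OF assms(1)]) (rule that)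
  obtain B1 \<beta>1 where fin1: "finite B1" and V1: "subspace V1" "\<Lambda>1 \<subseteq> V1"
    and lin1: "\<And>b. linear (\<beta>1 b)"
    and \<Lambda>1: "\<Lambda>1 = range (\<lambda>n :: 'b \<Rightarrow> int. \<Sum>b\<in>B1. of_int (n b) *\<^sub>R b)"
    and \<beta>1: "\<And>b n. b \<in> B1 \<Longrightarrow> \<beta>1 b (\<Sum>b\<in>B1. of_int (n b) *\<^sub>R b) = (of_int (n b) :: real)"
    by (rule lattice_in_coordinates[OF assms(2)]) (rule that)
  have \<beta>1_Ints: "\<beta>1 b x \<in> \<int>" if "b \<in> B1" "x \<in> \<Lambda>1" for b x
    using that(2) \<beta>1[OF that(1)] unfolding \<Lambda>1 by auto
  \<comment> \<open>The three components \<open>\<lambda>\<close>, \<open>\<mu>\<close> and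
    \<open>k\<close> are read off one integer vector; only its entries at basis vectors and at
    \<open>None\<close> enter.\<close>
  define \<phi>0 where "\<phi>0 z = (\<Sum>b\<in>B0. of_int (z (Some (Inl b))) *\<^sub>R b)"
    for z :: "('a + 'b) option \<Rightarrow> int"
  define \<phi>1 where "\<phi>1 z = (\<Sum>b\<in>B1. of_int (z (Some (Inr b))) *\<^sub>R b)"
    for z :: "('a + 'b) option \<Rightarrow> int"
  define \<kappa> where "\<kappa> z = real_of_int (z None)" for z :: "('a + 'b) option \<Rightarrow> int"
  have \<phi>0_lin: "int_linear \<phi>0"
    unfolding \<phi>0_def[abs_def] by (rule int_linear_coord_sum[OF fin0]) (simp add: inj_on_def)
  have \<phi>1_lin: "int_linear \<phi>1"
    unfolding \<phi>1_def[abs_def] by (rule int_linear_coord_sum[OF fin1]) (simp add: inj_on_def)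
  have \<kappa>_lin: "int_linear \<kappa>"
    unfolding \<kappa>_def[abs_def] by (rule int_linear_coord)
  have \<phi>0_mem: "\<phi>0 z \<in> \<Lambda>0" for z unfolding \<Lambda>0 \<phi>0_def by (rule range_eqI[where x = "\<lambda>b. z (Some (Inl b))"]) simp
  have \<phi>1_mem: "\<phi>1 z \<in> \<Lambda>1" for z unfolding \<Lambda>1 \<phi>1_def by (rule range_eqI[where x = "\<lambda>b. z (Some (Inr b))"]) simp

  from assms(4) obtain GP :: "(('a \<Rightarrow> real) \<times> real) set"
    where "finite GP \<and> (\<forall>(l, a)\<in>GP. linear l \<and> l ` \<Lambda>0 \<subseteq> \<rat> \<and> a \<in> \<rat>) \<and>
      P = {x \<in> V0. \<forall>(l, a)\<in>GP. l x \<le> a}"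
    unfolding rational_polyhedron_def ..
  then have fin_GP: "finite GP"
    and all_GP: "\<forall>(l, a)\<in>GP. linear l \<and> l ` \<Lambda>0 \<subseteq> \<rat> \<and> a \<in> \<rat>"
    and P: "P = {x \<in> V0. \<forall>(l, a)\<in>GP. l x \<le> a}"
    by blast+
  have "linear l \<and> l ` \<Lambda>0 \<subseteq> \<rat> \<and> a \<in> \<rat>" if "(l, a) \<in> GP" for l a
    using bspec[OF all_GP that] by simp
  note GP = fin_GP this
  have C01: "rational_polyhedron (V0 \<times> V1) (\<Lambda>0 \<times> \<Lambda>1) C01" "cone C01" "0 \<in> C01"
    using assms(3) by (simp_all add: rational_cone_def)
  from C01(1) obtain GC :: "(('a \<times> 'b \<Rightarrow> real) \<times> real) set"
    where "finite GC \<and> (\<forall>(l, a)\<in>GC. linear l \<and> l ` (\<Lambda>0 \<times> \<Lambda>1) \<subseteq> \<rat> \<and> a \<in> \<rat>) \<and>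
      C01 = {x \<in> V0 \<times> V1. \<forall>(l, a)\<in>GC. l x \<le> a}"
    unfolding rational_polyhedron_def ..
  then have fin_GC: "finite GC"
    and all_GC: "\<forall>(l, a)\<in>GC. linear l \<and> l ` (\<Lambda>0 \<times> \<Lambda>1) \<subseteq> \<rat> \<and> a \<in> \<rat>"
    and C_le: "C01 = {x \<in> V0 \<times> V1. \<forall>(l, a)\<in>GC. l x \<le> a}"
    by blast+
  have "linear l \<and> l ` (\<Lambda>0 \<times> \<Lambda>1) \<subseteq> \<rat> \<and> a \<in> \<rat>" if "(l, a) \<in> GC" for l a
    using bspec[OF all_GC that] by simp
  note GC = fin_GC this
  have C: "C01 = {x \<in> V0 \<times> V1. \<forall>(l, a)\<in>GC. l x \<le> 0}"
    by (rule cone_polyhedron_homogeneous[OF C01(2,3) C_le]) (use GC(2) in blast)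

  \<comment> \<open>The inequalities of one cone in \<open>(\<lambda>, \<mu>, k)\<close>: those of
    \<open>P\<close> are homogenised by \<open>k\<close>, and those of \<open>C01\<close> are
    homogeneous already.\<close>
  define \<G>P where "\<G>P = (\<lambda>(l, a) z. l (\<phi>0 z) - a * \<kappa> z) ` GP"
  define \<G>C where "\<G>C = (\<lambda>(l, a) z. l (\<phi>0 z, \<phi>1 z)) ` GC"
  have \<G>P: "int_linear (\<lambda>z. l (\<phi>0 z) - a * \<kappa> z) \<and> (\<forall>z. l (\<phi>0 z) - a * \<kappa> z \<in> \<rat>)"
    if "(l, a) \<in> GP" for l a
  proof
    have l: "linear l" using GP(2)[OF that] by blast
    have "linear (\<lambda>p. l (fst p) - a * snd p)"
      by (rule linearI) (simp_all add: linear_add[OF l] linear_cmul[OF l] algebra_simps)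
    from int_linear_compose[OF this int_linear_Pair[OF \<phi>0_lin \<kappa>_lin]]
    show "int_linear (\<lambda>z. l (\<phi>0 z) - a * \<kappa> z)" by simp
    show "\<forall>z. l (\<phi>0 z) - a * \<kappa> z \<in> \<rat>"
      using GP(2)[OF that] \<phi>0_mem by (auto simp: \<kappa>_def intro!: Rats_diff Rats_mult)
  qed
  have \<G>C: "int_linear (\<lambda>z. l (\<phi>0 z, \<phi>1 z)) \<and> (\<forall>z. l (\<phi>0 z, \<phi>1 z) \<in> \<rat>)"
    if "(l, a) \<in> GC" for l a
  proof
    show "int_linear (\<lambda>z. l (\<phi>0 z, \<phi>1 z))"
      using GC(2)[OF that] by (intro int_linear_compose[OF _ int_linear_Pair[OF \<phi>0_lin \<phi>1_lin]]) blast
    show "\<forall>z. l (\<phi>0 z, \<phi>1 z) \<in> \<rat>"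
      using GC(2)[OF that] \<phi>0_mem \<phi>1_mem by blast
  qed
  have "\<exists>F. finite F \<and> (\<forall>l\<in>F. additive_form l) \<and>
      lattice_cone F = {z. \<forall>\<phi>\<in>\<G>P \<union> \<G>C. \<phi> z \<le> 0}"
  proof (rule int_linear_rational_cone)
    show "finite (\<G>P \<union> \<G>C)" using GP(1) GC(1) by (simp add: \<G>P_def \<G>C_def)
    fix \<phi> assume "\<phi> \<in> \<G>P \<union> \<G>C"
    then show "int_linear \<phi> \<and> (\<forall>z. \<phi> z \<in> \<rat>)"
      using \<G>P \<G>C unfolding \<G>P_def \<G>C_def by (elim UnE imageE) auto
  qed
  then obtain F where F: "finite F" "\<And>l. l \<in> F \<Longrightarrow> additive_form l"
    and F_eq: "lattice_cone F = {z. \<forall>\<phi>\<in>\<G>P \<union> \<G>C. \<phi> z \<le> 0}" by blast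

  define q where "q z = qP (\<phi>0 z, \<kappa> z) * c (\<phi>0 z, \<phi>1 z)" for z
  have q: "q \<in> qpoly"
  proof -
    have "(\<lambda>z. qP (\<phi>0 z, \<kappa> z)) \<in> qpoly"
      by (rule qpoly_pullback[OF assms(6) int_linear_Pair[OF \<phi>0_lin \<kappa>_lin]])
        (simp add: \<phi>0_mem \<kappa>_def)
    moreover have "(\<lambda>z. c (\<phi>0 z, \<phi>1 z)) \<in> qpoly"
      by (rule qpoly_pullback[OF assms(7) int_linear_Pair[OF \<phi>0_lin \<phi>1_lin]])
        (simp add: \<phi>0_mem \<phi>1_mem)
    ultimately show ?thesis unfolding q_def[abs_def] by (rule qpoly.mult)
  qed
  \<comment> \<open>For \<open>k > 0\<close> the cut-off by the cone over \<open>P\<close> and the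
    condition from \<open>C01\<close> merge into membership in a single lattice cone.\<close>
  have summand: "(if (\<phi>0 z, \<phi>1 z) \<in> C01 then cut_off qP P (\<phi>0 z, \<kappa> z) * c (\<phi>0 z, \<phi>1 z) else 0)
      = (if z \<in> lattice_cone F then q z else 0)" if "\<kappa> z > 0" for z
  proof -
    have "(\<phi>0 z, \<kappa> z) \<in> cone_over P \<longleftrightarrow> (\<forall>(l, a)\<in>GP. l (\<phi>0 z) - a * \<kappa> z \<le> 0)"
      unfolding P using that V0 \<phi>0_mem GP(2) by (intro cone_over_polyhedron_iff) auto
    moreover have "(\<phi>0 z, \<phi>1 z) \<in> C01 \<longleftrightarrow> (\<forall>(l, a)\<in>GC. l (\<phi>0 z, \<phi>1 z) \<le> 0)"
      unfolding C using V0(2) V1(2) \<phi>0_mem \<phi>1_mem by auto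
    moreover have "z \<in> lattice_cone F \<longleftrightarrow> (\<forall>(l, a)\<in>GP. l (\<phi>0 z) - a * \<kappa> z \<le> 0)
        \<and> (\<forall>(l, a)\<in>GC. l (\<phi>0 z, \<phi>1 z) \<le> 0)"
      unfolding F_eq \<G>P_def \<G>C_def by (simp add: ball_Un case_prod_beta)
    ultimately have "z \<in> lattice_cone F \<longleftrightarrow> (\<phi>0 z, \<kappa> z) \<in> cone_over P \<and> (\<phi>0 z, \<phi>1 z) \<in> C01"
      by blast
    then show ?thesis by (simp add: cut_off_def q_def)
  qed

  define B :: "('a + 'b) option set" where "B = (\<lambda>b. Some (Inl b)) ` B0"
  have "finite B" using fin0 by (simp add: B_def)
  from fibre_infsum_cone_qpoly[OF this F q] obtain G where G: "G \<in> cone_qpoly UNIV"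
    "\<And>z. (\<Sum>\<^sub>\<infinity>w\<in>fibre_off B z. if w \<in> lattice_cone F then q w else 0) = G z" by blast
  \<comment> \<open>The coordinates of \<open>\<lambda>\<close> are free on the fibre. All others,
    including indices that belong to no basis vector, are fixed by \<open>z\<close>, which makes the
    map injective.\<close>
  have bij: "bij_betw \<phi>0 (fibre_off B z) \<Lambda>0" for z
  proof (rule bij_betw_imageI)
    show "inj_on \<phi>0 (fibre_off B z)"
    proof (rule inj_onI, rule ext)
      fix w w' i assume w: "w \<in> fibre_off B z" "w' \<in> fibre_off B z" and eq: "\<phi>0 w = \<phi>0 w'"
      show "w i = w' i"
      proof (cases "i \<in> B")
        case True
        then obtain b where b: "b \<in> B0" "i = Some (Inl b)" by (auto simp: B_def)
        have "real_of_int (w (Some (Inl b))) = \<beta>0 b (\<phi>0 w)"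
          unfolding \<phi>0_def by (rule \<beta>0[OF b(1), of "\<lambda>b. w (Some (Inl b))", symmetric])
        also have "\<dots> = of_int (w' (Some (Inl b)))"
          unfolding eq unfolding \<phi>0_def by (rule \<beta>0[OF b(1), of "\<lambda>b. w' (Some (Inl b))"])
        finally show ?thesis by (simp add: b(2))
      next
        case False
        then show ?thesis using w by (simp add: fibre_off_def)
      qed
    qed
    show "\<phi>0 ` fibre_off B z = \<Lambda>0"
    proof (intro equalityI subsetI)
      fix x assume "x \<in> \<Lambda>0"
      then obtain n :: "'a \<Rightarrow> int" where x: "x = (\<Sum>b\<in>B0. of_int (n b) *\<^sub>R b)" unfolding \<Lambda>0 by blast
      define w where "w i = (if i \<in> B then n (projl (the i)) else z i)" for i
      have "x = \<phi>0 w" unfolding x \<phi>0_def by (intro sum.cong) (auto simp: w_def B_def)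
      moreover have "w \<in> fibre_off B z" by (simp add: fibre_off_def w_def)
      ultimately show "x \<in> \<phi>0 ` fibre_off B z" by (rule image_eqI)
    qed (use \<phi>0_mem in auto)
  qed
  have push: "push_sum \<Lambda>0 C01 (cut_off qP P) c (\<mu>, k)
      = (if k > 0 then G (lattice_section B1 \<beta>1 (\<mu>, k)) else 0)"
    if \<mu>: "\<mu> \<in> \<Lambda>1" and k: "k \<in> \<int>" "k \<noteq> 0" for \<mu> k
  proof (cases "k > 0")
    case True
    \<comment> \<open>The base point has the coordinates of \<open>(\<mu>, k)\<close> and zeros for
      \<open>\<lambda>\<close>, so its fibre runs over all lattice points above
      \<open>(\<mu>, k)\<close>.\<close>
    define z :: "('a + 'b) option \<Rightarrow> int" where "z = lattice_section B1 \<beta>1 (\<mu>, k)"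
    have w: "\<phi>1 w = \<mu>" "\<kappa> w = k" if "w \<in> fibre_off B z" for w
    proof -
      obtain n :: "'b \<Rightarrow> int" where n: "\<mu> = (\<Sum>b\<in>B1. of_int (n b) *\<^sub>R b)"
        using \<mu> unfolding \<Lambda>1 by blast
      have "w i = z i" if "i \<notin> B" for i
        using \<open>w \<in> fibre_off B z\<close> that by (simp add: fibre_off_def)
      then have wz: "w (Some (Inr b)) = z (Some (Inr b))" "w None = z None" for b
        by (auto simp: B_def)
      have "of_int (z (Some (Inr b))) = (of_int (n b) :: real)" if "b \<in> B1" for b
        using that \<beta>1[OF that, of n] by (simp add: z_def lattice_section_simps n)
      then show "\<phi>1 w = \<mu>" unfolding \<phi>1_def wz n by (intro sum.cong) auto
      have "of_int \<lfloor>k\<rfloor> = k" by (rule Ints_cases[OF k(1)]) simp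
      then show "\<kappa> w = k" by (simp add: \<kappa>_def wz z_def lattice_section_simps)
    qed
    have "push_sum \<Lambda>0 C01 (cut_off qP P) c (\<mu>, k)
        = (\<Sum>\<^sub>\<infinity>x\<in>\<Lambda>0. if (x, \<mu>) \<in> C01 then cut_off qP P (x, k) * c (x, \<mu>) else 0)"
      unfolding push_sum_def prod.case by (intro infsum_cong_neutral) auto
    also have "\<dots> = (\<Sum>\<^sub>\<infinity>w\<in>fibre_off B z.
        if (\<phi>0 w, \<mu>) \<in> C01 then cut_off qP P (\<phi>0 w, k) * c (\<phi>0 w, \<mu>) else 0)"
      by (rule infsum_reindex_bij_betw[OF bij, symmetric])
    also have "\<dots> = (\<Sum>\<^sub>\<infinity>w\<in>fibre_off B z. if w \<in> lattice_cone F then q w else 0)"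
      by (intro infsum_cong) (use summand True w in metis)
    also have "\<dots> = G z" by (rule G(2))
    finally show ?thesis using True by (simp add: z_def)
  next
    case False
    then have "cut_off qP P (x, k) = 0" for x
      using k(2) cone_over_neg[of k x P] by (simp add: cut_off_def)
    then show ?thesis using False by (simp add: push_sum_def)
  qed
  have "\<exists>s\<in>S_space V1 \<Lambda>1. \<forall>\<mu>\<in>\<Lambda>1. \<forall>k\<in>\<int>. k \<noteq> 0 \<longrightarrow>
      s (\<mu>, k) = (if k > 0 then G (lattice_section B1 \<beta>1 (\<mu>, k)) else 0)"
    by (rule cone_qpoly_lattice_section[where A = UNIV, OF V1 fin1 lin1 _ G(1)]) (rule \<beta>1_Ints)
  then obtain s where s: "s \<in> S_space V1 \<Lambda>1" "\<forall>\<mu>\<in>\<Lambda>1. \<forall>k\<in>\<int>. k \<noteq> 0 \<longrightarrow>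
      s (\<mu>, k) = (if k > 0 then G (lattice_section B1 \<beta>1 (\<mu>, k)) else 0)"
    by blast
  show ?thesis
    by (intro bexI[OF _ s(1)] ballI impI) (rule trans[OF push s(2)[rule_format, symmetric]])
qed

end
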